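(* Let $k\geq 3$ be an integer. Then a random labeled tree and a random unlabeled tree are strongly $k$-balanced, i.e.: the proportion of strongly $k$-balanced trees among all labeled trees on $n$ vertices tends to $1$ as $n\rightarrow\infty$, and the proportion of strongly $k$-balanced trees among all unlabeled trees on $n$ vertices tends to $1$ as $n\rightarrow\infty$.
   Context: A labeled tree on $n$ vertices is a tree with vertex set $\{1,\ldots,n\}$; an unlabeled tree on $n$ vertices is an isomorphism class of trees with $n$ vertices. Random trees are taken with respect to the uniform distribution, and a statement about a random tree means that it holds with probability tending to $1$ as $n\to\infty$. For $k\geq 2$, a finite simple graph $G=(V,E)$ is called strongly $k$-balanced if there exists a map (coloring) $c:V\rightarrow\{1,\ldots,k\}$ such that no edge of $G$ has both endpoints of the same color, and $|v_i(c)-v_j(c)|\leq 1$ for all distinct $i,j\in\{1,\ldots,k\}$, where $v_i(c)=|c^{-1}(\{i\})|$. (Color classes may be empty.) *)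

theory Defs
  imports Complex_Main "HOL-Library.FuncSet" "HOL-Library.Ramsey"
begin

text \<open>A graph is a pair \<open>(V, E)\<close> whose edges are two-element subsets of \<open>V\<close>.\<close>

type_synonym 'a sgraph = "'a set \<times> 'a set set"

definition simple_graph :: "'a sgraph \<Rightarrow> bool" where
  "simple_graph G \<longleftrightarrow> finite (fst G) \<and> snd G \<subseteq> nsets (fst G) 2"

definition graph_connected :: "'a sgraph \<Rightarrow> bool" where
  "graph_connected G \<longleftrightarrow>
     fst G \<noteq> {} \<and> (\<forall>u\<in>fst G. \<forall>v\<in>fst G. (u, v) \<in> {(x, y). {x, y} \<in> snd G}\<^sup>*)"

text \<open>A cycle is given by the list of its vertices, without repeating the first one at the end.\<close>

definition graph_cycle :: "'a sgraph \<Rightarrow> 'a list \<Rightarrow> bool" where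
  "graph_cycle G p \<longleftrightarrow>
     3 \<le> length p \<and> distinct p \<and>
     (\<forall>i<length p. {p ! i, p ! (Suc i mod length p)} \<in> snd G)"

definition is_tree :: "'a sgraph \<Rightarrow> bool" where
  "is_tree G \<longleftrightarrow> simple_graph G \<and> graph_connected G \<and> (\<nexists>p. graph_cycle G p)"

definition graph_isomorphic :: "'a sgraph \<Rightarrow> 'b sgraph \<Rightarrow> bool" where
  "graph_isomorphic G H \<longleftrightarrow>
     (\<exists>f. bij_betw f (fst G) (fst H) \<and>
          (\<forall>u\<in>fst G. \<forall>v\<in>fst G. {u, v} \<in> snd G \<longleftrightarrow> {f u, f v} \<in> snd H))"

definition strongly_balanced :: "nat \<Rightarrow> 'a sgraph \<Rightarrow> bool" where
  "strongly_balanced k G \<longleftrightarrow>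
     (\<exists>c \<in> fst G \<rightarrow> {1..k}.
        (\<forall>u v. {u, v} \<in> snd G \<longrightarrow> c u \<noteq> c v) \<and>
        (\<forall>i\<in>{1..k}. \<forall>j\<in>{1..k}. i \<noteq> j \<longrightarrow>
           \<bar>int (card {v \<in> fst G. c v = i}) - int (card {v \<in> fst G. c v = j})\<bar> \<le> 1))"

definition labeled_trees :: "nat \<Rightarrow> nat sgraph set" where
  "labeled_trees n = {G. is_tree G \<and> fst G = {1..n}}"

text \<open>
  Every tree with \<open>n\<close> vertices, over any type of vertices, is isomorphic to one with vertex set
  \<open>{1..n}\<close> (see \<open>ex_isomorphic_labeled_tree\<close>), so the isomorphism classes of trees with \<open>n\<close>
  vertices are represented by the isomorphism classes within \<open>labeled_trees n\<close>.
\<close>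

definition unlabeled_trees :: "nat \<Rightarrow> nat sgraph set set" where
  "unlabeled_trees n =
     labeled_trees n // {(G, H). G \<in> labeled_trees n \<and> H \<in> labeled_trees n \<and> graph_isomorphic G H}"

text \<open>
  Strong balancedness is invariant under isomorphism (see \<open>strongly_balanced_isomorphic\<close>), so it
  makes no difference whether one or all members of the nonempty class \<open>C\<close> are required to have it.
\<close>

definition unlabeled_strongly_balanced :: "nat \<Rightarrow> 'a sgraph set \<Rightarrow> bool" where
  "unlabeled_strongly_balanced k C \<longleftrightarrow> (\<forall>G\<in>C. strongly_balanced k G)"


lemma simple_graph_edgeD:
  assumes "simple_graph G" "{u, v} \<in> snd G"
  shows "u \<in> fst G" "v \<in> fst G" "u \<noteq> v"
  using assms by (auto simp: simple_graph_def nsets_def card_insert_if split: if_splits)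

lemma simple_graph_edgeE:
  assumes "simple_graph G" "e \<in> snd G"
  obtains u v where "e = {u, v}" "u \<in> fst G" "v \<in> fst G" "u \<noteq> v"
  using assms by (auto simp: simple_graph_def nsets_def card_2_iff)

lemma graph_isomorphic_refl: "graph_isomorphic G G"
  unfolding graph_isomorphic_def by (rule exI[of _ id]) auto

lemma graph_isomorphic_sym:
  assumes "graph_isomorphic G H"
  shows "graph_isomorphic H G"
proof -
  obtain f where f: "bij_betw f (fst G) (fst H)"
    and e: "\<And>u v. u \<in> fst G \<Longrightarrow> v \<in> fst G \<Longrightarrow> {u, v} \<in> snd G \<longleftrightarrow> {f u, f v} \<in> snd H"
    using assms by (auto simp: graph_isomorphic_def)
  let ?g = "inv_into (fst G) f"
  have g: "bij_betw ?g (fst H) (fst G)"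
    using f by (rule bij_betw_inv_into)
  have "{u, v} \<in> snd H \<longleftrightarrow> {?g u, ?g v} \<in> snd G" if "u \<in> fst H" "v \<in> fst H" for u v
    using e[of "?g u" "?g v"] that bij_betwE[OF g] bij_betw_inv_into_right[OF f] by simp
  with g show ?thesis
    unfolding graph_isomorphic_def by blast
qed

lemma graph_isomorphic_trans:
  assumes "graph_isomorphic G H" "graph_isomorphic H K"
  shows "graph_isomorphic G K"
proof -
  obtain f where f: "bij_betw f (fst G) (fst H)"
    and ef: "\<And>u v. u \<in> fst G \<Longrightarrow> v \<in> fst G \<Longrightarrow> {u, v} \<in> snd G \<longleftrightarrow> {f u, f v} \<in> snd H"
    using assms(1) by (auto simp: graph_isomorphic_def)
  obtain g where g: "bij_betw g (fst H) (fst K)"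
    and eg: "\<And>u v. u \<in> fst H \<Longrightarrow> v \<in> fst H \<Longrightarrow> {u, v} \<in> snd H \<longleftrightarrow> {g u, g v} \<in> snd K"
    using assms(2) by (auto simp: graph_isomorphic_def)
  have "bij_betw (g \<circ> f) (fst G) (fst K)"
    using f g by (rule bij_betw_trans)
  moreover have "\<forall>u\<in>fst G. \<forall>v\<in>fst G. {u, v} \<in> snd G \<longleftrightarrow> {(g \<circ> f) u, (g \<circ> f) v} \<in> snd K"
    using ef eg bij_betwE[OF f] by simp
  ultimately show ?thesis
    unfolding graph_isomorphic_def by blast
qed

lemma equiv_graph_isomorphic:
  "equiv (labeled_trees n)
     {(G, H). G \<in> labeled_trees n \<and> H \<in> labeled_trees n \<and> graph_isomorphic G H}"
  by (rule equivI)
     (auto simp: refl_on_def sym_on_def trans_on_def graph_isomorphic_refl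
           intro: graph_isomorphic_sym graph_isomorphic_trans)

lemma finite_labeled_trees: "finite (labeled_trees n)"
proof (rule finite_subset)
  show "labeled_trees n \<subseteq> {{1..n}} \<times> Pow (Pow {1..n})"
    by (fastforce simp: labeled_trees_def is_tree_def simple_graph_def nsets_def
          simp del: atLeastAtMost_iff)
qed simp

lemma finite_unlabeled_trees: "finite (unlabeled_trees n)"
  unfolding unlabeled_trees_def
  by (rule finite_quotient[OF finite_labeled_trees]) auto

lemma strongly_balanced_isomorphic:
  assumes iso: "graph_isomorphic G H" and H: "simple_graph H" and bal: "strongly_balanced k G"
  shows "strongly_balanced k H"
proof -
  obtain f where f: "bij_betw f (fst H) (fst G)"
    and e: "\<And>u v. u \<in> fst H \<Longrightarrow> v \<in> fst H \<Longrightarrow> {u, v} \<in> snd H \<longleftrightarrow> {f u, f v} \<in> snd G"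
    using graph_isomorphic_sym[OF iso] by (auto simp: graph_isomorphic_def)
  obtain c where c: "c \<in> fst G \<rightarrow> {1..k}" "\<And>u v. {u, v} \<in> snd G \<Longrightarrow> c u \<noteq> c v"
    and d: "\<forall>i\<in>{1..k}. \<forall>j\<in>{1..k}. i \<noteq> j \<longrightarrow>
           \<bar>int (card {v \<in> fst G. c v = i}) - int (card {v \<in> fst G. c v = j})\<bar> \<le> 1"
    using bal unfolding strongly_balanced_def by blast
  have card: "card {v \<in> fst H. (c \<circ> f) v = i} = card {v \<in> fst G. c v = i}" for i
  proof (rule bij_betw_same_card)
    show "bij_betw f {v \<in> fst H. (c \<circ> f) v = i} {v \<in> fst G. c v = i}"
      using f by (auto simp: bij_betw_def inj_on_def)
  qed
  have "c \<circ> f \<in> fst H \<rightarrow> {1..k}"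
    using c(1) bij_betwE[OF f] by auto
  moreover have "\<forall>u v. {u, v} \<in> snd H \<longrightarrow> (c \<circ> f) u \<noteq> (c \<circ> f) v"
    using c(2) e simple_graph_edgeD(1,2)[OF H] by (metis comp_apply)
  ultimately show ?thesis
    unfolding strongly_balanced_def using d by (intro bexI[of _ "c \<circ> f"]) (simp_all only: card)
qed

lemma rtrancl_map:
  assumes "(x, y) \<in> r\<^sup>*" "\<And>a b. (a, b) \<in> r \<Longrightarrow> (f a, f b) \<in> s"
  shows "(f x, f y) \<in> s\<^sup>*"
  using assms(1) by induction (auto intro: rtrancl_into_rtrancl assms(2))

lemma is_tree_isomorphic:
  assumes iso: "graph_isomorphic G H" and H: "simple_graph H" and G: "is_tree G"
  shows "is_tree H"
proof -
  have sG: "simple_graph G" and cG: "graph_connected G" and aG: "\<nexists>p. graph_cycle G p"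
    using G by (auto simp: is_tree_def)
  obtain f where f: "bij_betw f (fst G) (fst H)"
    and ef: "\<And>u v. u \<in> fst G \<Longrightarrow> v \<in> fst G \<Longrightarrow> {u, v} \<in> snd G \<longleftrightarrow> {f u, f v} \<in> snd H"
    using iso by (auto simp: graph_isomorphic_def)
  obtain g where g: "bij_betw g (fst H) (fst G)"
    and eg: "\<And>u v. u \<in> fst H \<Longrightarrow> v \<in> fst H \<Longrightarrow> {u, v} \<in> snd H \<longleftrightarrow> {g u, g v} \<in> snd G"
    using graph_isomorphic_sym[OF iso] by (auto simp: graph_isomorphic_def)
  have eG: "(f a, f b) \<in> {(x, y). {x, y} \<in> snd H}" if "(a, b) \<in> {(x, y). {x, y} \<in> snd G}" for a b
  proof -
    have "{a, b} \<in> snd G"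
      using that by simp
    then show ?thesis
      using ef[of a b] simple_graph_edgeD[OF sG] by simp
  qed
  have "graph_connected H"
    unfolding graph_connected_def
  proof (intro conjI ballI)
    show "fst H \<noteq> {}"
      using cG f by (auto simp: graph_connected_def bij_betw_def)
    fix u v assume "u \<in> fst H" "v \<in> fst H"
    then obtain x y where xy: "x \<in> fst G" "y \<in> fst G" "u = f x" "v = f y"
      using f unfolding bij_betw_def by blast
    then have "(x, y) \<in> {(x, y). {x, y} \<in> snd G}\<^sup>*"
      using cG by (auto simp: graph_connected_def)
    from rtrancl_map[of _ _ _ f, OF this eG] show "(u, v) \<in> {(x, y). {x, y} \<in> snd H}\<^sup>*"
      using xy by simp
  qed
  moreover have "\<not> graph_cycle H p" for p
  proof
    assume p: "graph_cycle H p"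
    have V: "set p \<subseteq> fst H"
      using p simple_graph_edgeD(1)[OF H] unfolding graph_cycle_def in_set_conv_nth subset_iff
      by metis
    have "distinct (map g p)"
      using p V g by (auto simp: graph_cycle_def distinct_map bij_betw_def intro: inj_on_subset)
    moreover have "{map g p ! i, map g p ! (Suc i mod length p)} \<in> snd G" if "i < length p" for i
    proof -
      have j: "Suc i mod length p < length p"
        using that by (intro mod_less_divisor) linarith
      have "p ! i \<in> fst H" "p ! (Suc i mod length p) \<in> fst H"
        using V that j nth_mem by blast+
      then show ?thesis
        using p that j eg[of "p ! i" "p ! (Suc i mod length p)"] by (simp add: graph_cycle_def)
    qed
    ultimately have "graph_cycle G (map g p)"
      using p by (simp add: graph_cycle_def)
    with aG show False by blast
  qed
  ultimately show ?thesis
    using H by (simp add: is_tree_def)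
qed

lemma ex_isomorphic_labeled_tree:
  assumes G: "is_tree G" and n: "card (fst G) = n"
  shows "\<exists>H\<in>labeled_trees n. graph_isomorphic G H"
proof -
  have sG: "simple_graph G"
    using G by (simp add: is_tree_def)
  then have "finite (fst G)"
    by (simp add: simple_graph_def)
  then obtain f where f: "bij_betw f (fst G) {1..n}"
    using n finite_same_card_bij[of "fst G" "{1..n}"] by auto
  define H where "H = ({1..n}, (`) f ` snd G)"
  have inj: "inj_on f (fst G)" and im: "f ` fst G = {1..n}"
    using f by (auto simp: bij_betw_def)
  have sH: "simple_graph H"
    unfolding simple_graph_def
  proof (intro conjI subsetI)
    fix e assume "e \<in> snd H"
    then obtain d where d: "d \<in> snd G" "e = f ` d"
      by (auto simp: H_def)
    obtain u v where "d = {u, v}" "u \<in> fst G" "v \<in> fst G" "u \<noteq> v"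
      using simple_graph_edgeE[OF sG d(1)] .
    then have "e = {f u, f v}" "f u \<noteq> f v" "f u \<in> fst H" "f v \<in> fst H"
      using d(2) inj_on_eq_iff[OF inj] im unfolding H_def fst_conv by blast+
    then show "e \<in> nsets (fst H) 2"
      by (simp add: nsets_def)
  qed (simp add: H_def)
  have iso: "graph_isomorphic G H"
    unfolding graph_isomorphic_def
  proof (intro exI[of _ f] conjI ballI)
    show "bij_betw f (fst G) (fst H)"
      using f by (simp add: H_def)
    fix u v assume uv: "u \<in> fst G" "v \<in> fst G"
    have "{u, v} \<in> snd G" if "d \<in> snd G" "{f u, f v} = f ` d" for d
    proof -
      have "d \<subseteq> fst G"
        using sG that by (auto simp: simple_graph_def nsets_def)
      then have "{u, v} = d"
        using inj_on_image_eq_iff[OF inj, of "{u, v}" d] that uv by simp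
      with that show ?thesis by simp
    qed
    moreover have "{f u, f v} \<in> snd H" if "{u, v} \<in> snd G"
      using imageI[OF that, of "(`) f"] by (simp add: H_def)
    ultimately show "{u, v} \<in> snd G \<longleftrightarrow> {f u, f v} \<in> snd H"
      unfolding H_def snd_conv by blast
  qed
  have "H \<in> labeled_trees n"
    using is_tree_isomorphic[OF iso sH G] by (simp add: labeled_trees_def H_def)
  with iso show ?thesis by blast
qed

end

theory Submission
  imports Defs "HOL-Library.Multiset" "HOL-Real_Asymp.Real_Asymp"
begin

text \<open>
  A tree on sufficiently many vertices, say \<open>n\<close>, all of whose degrees are less than \<open>n / 36\<close> is strongly \<open>k\<close>-balanced for
  \<open>k \<ge> 3\<close>. Let \<open>X\<close>, \<open>Y\<close> be its sides with \<open>card Y \<le> card X\<close>. If \<open>Y\<close> has at least \<open>n / k\<close> vertices,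
  fill as many colour classes as possible inside \<open>Y\<close>, leaving over the vertices of smallest degree;
  they have few neighbours, so the mixed class can be completed from \<open>X\<close>. If \<open>Y\<close> is smaller, split it
  into \<open>S\<close> and \<open>Z\<close>, add to \<open>Z\<close> vertices of \<open>X\<close> that only see \<open>S\<close> and vice versa, and colour the rest
  of \<open>X\<close> arbitrarily. A split that balances the number of available vertices of \<open>X\<close> and in which at
  most two thirds of the vertices of degree two in \<open>X\<close> see both parts is good enough.

  It remains to see that a vertex of degree at least \<open>n / 36\<close> is rare. Labeled trees: hang one neighbour
  \<open>u\<close> of such a vertex \<open>v\<close> below another neighbour \<open>w\<close>. There are of order \<open>n\<^sup>2\<close> choices, but a tree
  arises in only \<open>O(n)\<close> ways, because \<open>w\<close> is determined by \<open>v\<close> and \<open>u\<close> and because \<open>v\<close> has almost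
  the same degree as before. Unlabeled trees: root the tree at \<open>v\<close>, remove three branches of bounded
  size, and distribute the other branches in consecutive blocks over a path that starts at the root
  and has three more vertices. There are of order \<open>n\<^sup>3\<close> choices, and a rooted tree arises in only
  \<open>O(n)\<close> ways, since only the end of the path has to be marked. The loss of another factor
  \<open>n\<close> between rooted and unrooted trees is harmless.
\<close>

section \<open>Colouring bipartite graphs with prescribed class sizes\<close>

lemma exists_map_with_fiber_cards:
  fixes t :: "'b \<Rightarrow> nat"
  assumes "finite A" "finite I" "card A = sum t I"
  shows "\<exists>c \<in> A \<rightarrow> I. \<forall>i\<in>I. card {v \<in> A. c v = i} = t i"
  using assms(2,1,3)
proof (induction I arbitrary: A rule: finite_induct)
  case empty
  then show ?case by auto
next
  case (insert j I)
  then have "t j \<le> card A" by simp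
  then obtain B where B: "B \<subseteq> A" "card B = t j"
    by (meson obtain_subset_with_card_n)
  then have "card (A - B) = sum t I"
    using insert by (simp add: card_Diff_subset finite_subset)
  with insert obtain c where c: "c \<in> A - B \<rightarrow> I" "\<forall>i\<in>I. card {v \<in> A - B. c v = i} = t i"
    by (metis finite_Diff)
  define c' where "c' = (\<lambda>v. if v \<in> B then j else c v)"
  have "{v \<in> A. c' v = j} = B"
    using B(1) c(1) insert.hyps by (auto simp: c'_def)
  moreover have "{v \<in> A. c' v = i} = {v \<in> A - B. c v = i}" if "i \<in> I" for i
    using that insert.hyps by (auto simp: c'_def)
  ultimately have "\<forall>i\<in>insert j I. card {v \<in> A. c' v = i} = t i"
    using B c by simp
  moreover have "c' \<in> A \<rightarrow> insert j I"
    using c(1) by (simp add: c'_def Pi_iff)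
  ultimately show ?case by blast
qed

text \<open>Deleting an element of maximal value cannot raise the average, so \<open>A\<close> can
  be shrunk down to \<open>b\<close> elements.\<close>

lemma exists_subset_sum_le_average:
  fixes f :: "'a \<Rightarrow> nat"
  assumes "finite A" "b \<le> card A"
  shows "\<exists>B\<subseteq>A. card B = b \<and> sum f B * card A \<le> b * sum f A"
  using assms
proof (induction "card A - b" arbitrary: A)
  case 0
  then show ?case by (intro exI[of _ A]) auto
next
  case (Suc m)
  then have "A \<noteq> {}" by auto
  with Suc.prems(1) obtain a where a: "a \<in> A" "f a = Max (f ` A)"
    by (metis (mono_tags, lifting) Max_in finite_imageI image_iff image_is_empty)
  then have max: "f x \<le> f a" if "x \<in> A" for x
    using that Suc.prems(1) by simp
  have c: "card A = Suc (card (A - {a}))"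
    using a Suc.prems(1) by (metis card.remove)
  then obtain B where B: "B \<subseteq> A - {a}" "card B = b"
      "sum f B * card (A - {a}) \<le> b * sum f (A - {a})"
    using Suc.hyps(1)[of "A - {a}"] Suc.hyps(2) Suc.prems by (metis Suc_diff_le Suc_inject Suc_leI
        diff_is_0_eq finite_Diff less_Suc_eq_le nat.distinct(1) not_less)
  have s: "sum f A = f a + sum f (A - {a})"
    using a Suc.prems(1) by (metis sum.remove)
  have "sum f B \<le> b * f a"
    using B max by (metis DiffE in_mono of_nat_id sum_bounded_above)
  then have "sum f B * card A \<le> b * sum f A"
    using B(3) unfolding c s by (simp add: algebra_simps)
  with B show ?case by blast
qed

text \<open>Greedy choice: if \<open>x\<close> is the current difference, one of
  \<open>x + w a\<close> and \<open>x - w a\<close> has absolute value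
  \<open>\<bar>\<bar>x\<bar> - \<bar>w a\<bar>\<bar>\<close>, which is at most \<open>M\<close>. The
  weights may be negative, as they can be in the later application.\<close>

lemma exists_balanced_split:
  fixes w :: "'a \<Rightarrow> int"
  assumes "finite A" "\<And>a. a \<in> A \<Longrightarrow> \<bar>w a\<bar> \<le> M" "0 \<le> M"
  shows "\<exists>S\<subseteq>A. \<bar>sum w S - sum w (A - S)\<bar> \<le> M"
  using assms(1,2)
proof (induction A rule: finite_induct)
  case empty
  then show ?case using assms(3) by auto
next
  case (insert a A)
  then obtain S where S: "S \<subseteq> A" "\<bar>sum w S - sum w (A - S)\<bar> \<le> M" by auto
  have fin: "finite S" "finite (A - S)" and a: "a \<notin> S" "\<bar>w a\<bar> \<le> M"
    using insert S finite_subset by auto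
  have "insert a A - insert a S = A - S" "insert a A - S = insert a (A - S)"
    using insert.hyps S(1) by auto
  then have "\<bar>sum w (insert a S) - sum w (insert a A - insert a S)\<bar> \<le> M \<or>
      \<bar>sum w S - sum w (insert a A - S)\<bar> \<le> M"
    using fin a insert.hyps S(2) by auto
  then show ?case
    using S(1) by (metis insert_mono subset_insertI2)
qed

text \<open>Edges are ordered pairs because the graphs to be coloured are bipartite and
  \<open>A\<close> is a subset of \<open>X \<times> Y\<close> later on.\<close>

definition colorable_with_sizes :: "('a \<times> 'a) set \<Rightarrow> 'a set \<Rightarrow> nat \<Rightarrow> (nat \<Rightarrow> nat) \<Rightarrow> bool" where
  "colorable_with_sizes A V k t \<longleftrightarrow> (\<exists>c \<in> V \<rightarrow> {1..k}. (\<forall>(x, y)\<in>A. c x \<noteq> c y) \<and>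
     (\<forall>i\<in>{1..k}. card {v \<in> V. c v = i} = t i))"

text \<open>\<open>P\<close> and \<open>Q\<close> are independent and have palettes of their own, so
  any distribution with the right class sizes is proper on them. Only \<open>B\<close> relies on the
  given colouring \<open>c0\<close>, and disjoint palettes prevent conflicts between the three
  sets.\<close>

lemma colorable_with_sizesI:
  assumes "finite P" "finite Q" "finite B" "P \<inter> Q = {}" "P \<inter> B = {}" "Q \<inter> B = {}"
    and "c0 \<in> B \<rightarrow> I0" "finite IP" "finite IQ" "I0 \<inter> IP = {}" "I0 \<inter> IQ = {}" "IP \<inter> IQ = {}"
    and "I0 \<union> IP \<union> IQ = {1..k}"
    and "card P = sum t IP" "card Q = sum t IQ"
    and "\<And>i. i \<in> I0 \<Longrightarrow> card {v \<in> B. c0 v = i} = t i"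
    and "A \<subseteq> (P \<union> Q \<union> B) \<times> (P \<union> Q \<union> B)"
    and "\<And>x y. (x, y) \<in> A \<Longrightarrow> \<not> (x \<in> P \<and> y \<in> P) \<and> \<not> (x \<in> Q \<and> y \<in> Q)"
    and "\<And>x y. (x, y) \<in> A \<Longrightarrow> x \<in> B \<Longrightarrow> y \<in> B \<Longrightarrow> c0 x \<noteq> c0 y"
  shows "colorable_with_sizes A (P \<union> Q \<union> B) k t"
proof -
  obtain p where p: "p \<in> P \<rightarrow> IP" "\<forall>i\<in>IP. card {v \<in> P. p v = i} = t i"
    using exists_map_with_fiber_cards[of P IP t] assms by auto
  obtain q where q: "q \<in> Q \<rightarrow> IQ" "\<forall>i\<in>IQ. card {v \<in> Q. q v = i} = t i"
    using exists_map_with_fiber_cards[of Q IQ t] assms by auto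
  define c where "c v = (if v \<in> P then p v else if v \<in> Q then q v else c0 v)" for v
  have P: "c v = p v" "c v \<in> IP" if "v \<in> P" for v using that p by (auto simp: c_def)
  have Q: "c v = q v" "c v \<in> IQ" if "v \<in> Q" for v using that q assms(4) by (auto simp: c_def)
  have B: "c v = c0 v" "c v \<in> I0" if "v \<in> B" for v
    using that assms(5,6,7) by (auto simp: c_def)
  let ?V = "P \<union> Q \<union> B"
  have "card {v \<in> ?V. c v = i} = t i" if i: "i \<in> {1..k}" for i
  proof -
    consider "i \<in> IP" | "i \<in> IQ" | "i \<in> I0" using assms(13) i by blast
    then show ?thesis
    proof cases
      case 1
      then have "v \<in> ?V \<and> c v = i \<longleftrightarrow> v \<in> P \<and> p v = i" for v
        using P[of v] Q[of v] B[of v] assms(10-12) by auto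
      then have "{v \<in> ?V. c v = i} = {v \<in> P. p v = i}" by blast
      then show ?thesis using p 1 by simp
    next
      case 2
      then have "v \<in> ?V \<and> c v = i \<longleftrightarrow> v \<in> Q \<and> q v = i" for v
        using P[of v] Q[of v] B[of v] assms(10-12) by auto
      then have "{v \<in> ?V. c v = i} = {v \<in> Q. q v = i}" by blast
      then show ?thesis using q 2 by simp
    next
      case 3
      then have "v \<in> ?V \<and> c v = i \<longleftrightarrow> v \<in> B \<and> c0 v = i" for v
        using P[of v] Q[of v] B[of v] assms(10-12) by auto
      then have "{v \<in> ?V. c v = i} = {v \<in> B. c0 v = i}" by blast
      then show ?thesis using assms(16) 3 by simp
    qed
  qed
  moreover have "c x \<noteq> c y" if "(x, y) \<in> A" for x y
  proof -
    have "x \<in> ?V" "y \<in> ?V" using that assms(17) by auto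
    then show ?thesis
      using assms(18,19)[OF that] P[of x] P[of y] Q[of x] Q[of y] B[of x] B[of y] assms(10-12)
      by (metis UnE disjoint_iff)
  qed
  moreover have "c \<in> ?V \<rightarrow> {1..k}"
    using P Q B assms(13) by blast
  ultimately show ?thesis
    unfolding colorable_with_sizes_def by blast
qed

text \<open>Colours 1 to \<open>j\<close> fill \<open>Y\<close> up to a set \<open>B\<close> of
  \<open>b\<close> vertices, class \<open>j + 1\<close> is \<open>B\<close> with
  \<open>u - b\<close> vertices of \<open>X\<close> that have no neighbour in \<open>B\<close>, and
  the other colours share the rest of \<open>X\<close>. As the average degree in \<open>B\<close> is
  at most that in \<open>Y\<close>, there are at most \<open>b * card A / card Y\<close>, hence at
  most \<open>b + b * card X / card Y\<close>, neighbours of \<open>B\<close>. This leaves at least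
  \<open>card X * s / card Y - b \<ge> s - b \<ge> u - b\<close> vertices of
  \<open>X\<close>.\<close>

lemma bipartite_coloring_large_side:
  fixes t :: "nat \<Rightarrow> nat"
  assumes fin: "finite X" "finite Y" and disj: "X \<inter> Y = {}" and A: "A \<subseteq> X \<times> Y"
    and edges: "card A < card X + card Y"
    and le: "card Y \<le> card X" and t1: "t 1 \<le> card Y" and k: "1 \<le> k"
    and sum: "sum t {1..k} = card X + card Y"
    and dec: "\<And>i. i \<in> {1..k} \<Longrightarrow> t i \<le> t 1"
    and pos: "\<And>i. i \<in> {1..k} \<Longrightarrow> 0 < t i"
  shows "colorable_with_sizes A (X \<union> Y) k t"
proof -
  have finA: "finite A" using A fin finite_subset by blast
  \<comment> \<open>The maximum \<open>j\<close> of \<open>J\<close> is the number of classes that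
    fit into \<open>Y\<close> together. It is at least 1 by \<open>t1\<close>, and below
    \<open>k\<close> because \<open>X\<close> is nonempty.\<close>
  define J where "J = {j. j \<le> k \<and> sum t {1..j} \<le> card Y}"
  have J: "finite J" "1 \<in> J" using k t1 by (auto simp: J_def)
  define j where "j = Max J"
  have j: "j \<in> J" "1 \<le> j" "\<And>i. i \<in> J \<Longrightarrow> i \<le> j"
    unfolding j_def using J by (auto intro: Max_in)
  have "card X > 0" using pos[of 1] k t1 le by simp
  then have "k \<notin> J" using sum by (simp add: J_def)
  then have jk: "j < k" using j(1) by (metis J_def linorder_neqE_nat mem_Collect_eq not_le)
  have S: "sum t {1..j} \<le> card Y" using j(1) by (simp add: J_def)
  have "Suc j \<notin> J" using j(3)[of "Suc j"] by auto
  then have S': "card Y < sum t {1..j} + t (Suc j)" using jk by (simp add: J_def)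
  define s where "s = sum t {1..j}"
  define b where "b = card Y - s"
  define u where "u = t (Suc j)"
  have us: "u \<le> s"
  proof -
    have "u \<le> t 1" using dec jk by (simp add: u_def)
    also have "t 1 \<le> s" unfolding s_def using j(2) by (intro member_le_sum) auto
    finally show ?thesis .
  qed
  have Y: "card Y = s + b" using S by (simp add: b_def s_def)
  have bu: "b < u" using S' Y by (simp add: s_def u_def)
  define deg where "deg y = card {x. (x, y) \<in> A}" for y
  have degA: "sum deg B = card {(x, y). (x, y) \<in> A \<and> y \<in> B}" if "B \<subseteq> Y" for B
  proof -
    have fB: "finite B" using that fin finite_subset by blast
    have f: "finite {x. (x, y) \<in> A}" for y
      by (rule finite_subset[OF _ fin(1)]) (use A in auto)
    have "sum deg B = card (SIGMA y:B. {x. (x, y) \<in> A})"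
      using fB f by (simp add: deg_def)
    also have "\<dots> = card {(x, y). (x, y) \<in> A \<and> y \<in> B}"
      by (rule bij_betw_same_card[of prod.swap]) (auto simp: bij_betw_def inj_on_def image_iff)
    finally show ?thesis .
  qed
  have "{(x, y). (x, y) \<in> A \<and> y \<in> Y} = A" using A by auto
  then have sumY: "sum deg Y = card A" using degA[of Y] by simp
  obtain B where B: "B \<subseteq> Y" "card B = b" "sum deg B * card Y \<le> b * card A"
    using exists_subset_sum_le_average[of Y b deg] fin Y sumY by auto
  define N where "N = {x. \<exists>y\<in>B. (x, y) \<in> A}"
  have NX: "N \<subseteq> X" using A by (auto simp: N_def)
  have finB: "finite {(x, y). (x, y) \<in> A \<and> y \<in> B}" by (rule finite_subset[OF _ finA]) auto
  have "N = fst ` {(x, y). (x, y) \<in> A \<and> y \<in> B}" by (force simp: N_def)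
  then have N: "card N \<le> sum deg B" unfolding degA[OF B(1)] by (simp only: card_image_le[OF finB])
  \<comment> \<open>The estimate is multiplied by \<open>card Y = s + b\<close> and carried out over
    the integers, away from truncated subtraction.\<close>
  have "u - b \<le> card X - card N"
  proof -
    have "card N * (s + b) \<le> b * card A"
      using N B(3) Y by (metis mult_le_mono1 order_trans)
    also have "\<dots> \<le> b * (card X + (s + b))"
      using edges Y by simp
    finally have 1: "int (card N) * (int s + int b) \<le> int b * (int (card X) + (int s + int b))"
      by (metis of_nat_add of_nat_le_iff of_nat_mult)
    have "(int s + int b) * int u \<le> (int s + int b) * int s"
      using us by (intro mult_left_mono) auto
    also have "\<dots> \<le> int (card X) * int s"
      using le Y by (intro mult_right_mono) auto
    finally have "int (card X) * int s \<ge> (int s + int b) * int u" .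
    with 1 have "(int s + int b) * (int u - int b) \<le> (int s + int b) * (int (card X) - int (card N))"
      by (simp add: algebra_simps)
    moreover have "0 < int s + int b" using us bu by simp
    ultimately have "int u - int b \<le> int (card X) - int (card N)"
      by (simp add: mult_le_cancel_left)
    then show ?thesis by linarith
  qed
  then have "u - b \<le> card (X - N)"
    using NX fin by (simp add: card_Diff_subset finite_subset)
  then obtain C where C: "C \<subseteq> X - N" "card C = u - b"
    by (meson obtain_subset_with_card_n)
  have cXC: "card (X - C) = card X - (u - b)" "card (Y - B) = s" "card (B \<union> C) = u"
  proof -
    show "card (X - C) = card X - (u - b)" using C fin by (metis Diff_subset card_Diff_subset finite_subset order_trans)
    show "card (Y - B) = s" using B Y fin by (simp add: card_Diff_subset finite_subset)
    have "B \<inter> C = {}" using B C disj by auto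
    then show "card (B \<union> C) = u" using B C bu fin
      by (subst card_Un_disjoint) (auto intro: finite_subset)
  qed
  have part: "{1..k} = {1..j} \<union> ({Suc j} \<union> {Suc (Suc j)..k})" using jk by auto
  have "sum t {1..k} = s + (u + sum t {Suc (Suc j)..k})"
    unfolding part s_def u_def by (subst sum.union_disjoint; simp)+
  then have rest: "card (X - C) = sum t {Suc (Suc j)..k}"
    using sum Y cXC bu by simp
  have "colorable_with_sizes A ((Y - B) \<union> (X - C) \<union> (B \<union> C)) k t"
  proof (rule colorable_with_sizesI[where ?c0.0 = "\<lambda>_. Suc j" and ?I0.0 = "{Suc j}" and IP = "{1..j}"
        and IQ = "{Suc (Suc j)..k}"])
    show "A \<subseteq> ((Y - B) \<union> (X - C) \<union> (B \<union> C)) \<times> ((Y - B) \<union> (X - C) \<union> (B \<union> C))"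
      using A by auto
    show "card {v \<in> B \<union> C. Suc j = i} = t i" if "i \<in> {Suc j}" for i
    proof -
      have "{v \<in> B \<union> C. Suc j = i} = B \<union> C" using that by auto
      then show ?thesis using that cXC(3) by (simp add: u_def)
    qed
    show "\<not> (x \<in> Y - B \<and> y \<in> Y - B) \<and> \<not> (x \<in> X - C \<and> y \<in> X - C)" if "(x, y) \<in> A" for x y
      using that A disj by auto
    show "Suc j \<noteq> Suc j" if "(x, y) \<in> A" "x \<in> B \<union> C" "y \<in> B \<union> C" for x y
      using that A disj B C by (auto simp: N_def)
    show "finite (B \<union> C)" using fin B C by (meson Diff_subset finite_UnI finite_subset)
    show "card (Y - B) = sum t {1..j}" using cXC by (simp add: s_def)
    show "(Y - B) \<inter> (X - C) = {}" "(Y - B) \<inter> (B \<union> C) = {}" "(X - C) \<inter> (B \<union> C) = {}"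
      using B C disj by auto
  qed (use fin rest part in auto)
  moreover have "(Y - B) \<union> (X - C) \<union> (B \<union> C) = X \<union> Y" using B C by auto
  ultimately show ?thesis by simp
qed

lemma sum_card_fibers:
  assumes "finite X" "finite Y" "A \<subseteq> X \<times> Y"
  shows "(\<Sum>x\<in>X. card {y. (x, y) \<in> A}) = card A"
proof -
  have "finite {y. (x, y) \<in> A}" for x
    by (rule finite_subset[OF _ assms(2)]) (use assms(3) in auto)
  then have "(\<Sum>x\<in>X. card {y. (x, y) \<in> A}) = card (SIGMA x:X. {y. (x, y) \<in> A})"
    using assms by simp
  also have "(SIGMA x:X. {y. (x, y) \<in> A}) = A" using assms by auto
  finally show ?thesis .
qed

text \<open>
  Among the three ways of pairing up four parts, every pair of elements is separated by at most two.
\<close>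

lemma exists_split_with_small_cut:
  fixes w :: "'a \<Rightarrow> int" and N :: "'b \<Rightarrow> 'a set"
  assumes fin: "finite Y" "finite P" and w: "\<And>y. y \<in> Y \<Longrightarrow> \<bar>w y\<bar> \<le> M" and M: "0 \<le> M"
    and N: "\<And>x. x \<in> P \<Longrightarrow> N x \<subseteq> Y \<and> card (N x) = 2"
  shows "\<exists>S\<subseteq>Y. \<bar>sum w S - sum w (Y - S)\<bar> \<le> 2 * M \<and> 3 * card {x \<in> P. card (N x \<inter> S) = 1} \<le> 2 * card P"
proof -
  obtain S1 where S1: "S1 \<subseteq> Y" "\<bar>sum w S1 - sum w (Y - S1)\<bar> \<le> M"
    using exists_balanced_split[of Y w M] assms by auto
  \<comment> \<open>Splitting both halves again gives parts \<open>B\<close>, \<open>D\<close> of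
    \<open>S1\<close> and \<open>C\<close>, \<open>E\<close> of the rest. The recombinations
    \<open>B \<union> C\<close> and \<open>B \<union> E\<close> inherit an error of at most
    \<open>M\<close> from each half.\<close>
  obtain B where B: "B \<subseteq> S1" "\<bar>sum w B - sum w (S1 - B)\<bar> \<le> M"
    using exists_balanced_split[of S1 w M] assms S1 by (meson finite_subset subset_iff)
  obtain C where C: "C \<subseteq> Y - S1" "\<bar>sum w C - sum w (Y - S1 - C)\<bar> \<le> M"
    using exists_balanced_split[of "Y - S1" w M] assms by auto
  define D where "D = S1 - B"
  define E where "E = Y - S1 - C"
  have f: "finite B" "finite C" "finite D" "finite E"
    using fin S1 B C by (auto simp: D_def E_def intro: finite_subset)
  have dj: "B \<inter> C = {}" "B \<inter> D = {}" "B \<inter> E = {}" "C \<inter> D = {}" "C \<inter> E = {}" "D \<inter> E = {}"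
    using S1 B C by (auto simp: D_def E_def)
  have Y: "Y = B \<union> D \<union> (C \<union> E)" and S1_eq: "S1 = B \<union> D" using S1 B C by (auto simp: D_def E_def)
  have bd: "\<bar>sum w B - sum w D\<bar> \<le> M" "\<bar>sum w C - sum w E\<bar> \<le> M"
    using B C by (auto simp: D_def E_def)
  define S2 where "S2 = B \<union> C"
  define S3 where "S3 = B \<union> E"
  have "Y - S2 = D \<union> E" "Y - S3 = D \<union> C" unfolding Y S2_def S3_def using dj by auto
  then have bal: "\<bar>sum w S2 - sum w (Y - S2)\<bar> \<le> 2 * M" "\<bar>sum w S3 - sum w (Y - S3)\<bar> \<le> 2 * M"
    using bd f dj by (simp_all add: S2_def S3_def sum.union_disjoint Int_commute)
  define cut where "cut S = {x \<in> P. card (N x \<inter> S) = 1}" for S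
  have fc: "finite (cut S)" for S using fin by (simp add: cut_def)
  \<comment> \<open>\<open>S3\<close> contains an element of \<open>Y\<close> exactly when
    \<open>S1\<close> and \<open>S2\<close> agree on it. A pair separated by both \<open>S1\<close>
    and \<open>S2\<close> is therefore not separated by \<open>S3\<close>.\<close>
  have "(\<Sum>S\<leftarrow>[S1, S2, S3]. of_bool (x \<in> cut S)) \<le> (2::nat)" if x: "x \<in> P" for x
  proof -
    obtain a b where ab: "N x = {a, b}" "a \<noteq> b" using N[OF x] by (meson card_2_iff)
    then have aY: "a \<in> Y" "b \<in> Y" using N[OF x] by auto
    have S3: "v \<in> S3 \<longleftrightarrow> (v \<in> S1 \<longleftrightarrow> v \<in> S2)" if "v \<in> Y" for v
      using that dj unfolding Y S1_eq S2_def S3_def by blast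
    have "card (N x \<inter> S) = of_bool (a \<in> S) + of_bool (b \<in> S)" for S
      using ab by (auto simp: Int_insert_left)
    then have c: "x \<in> cut S \<longleftrightarrow> (a \<in> S) \<noteq> (b \<in> S)" for S
      using x by (auto simp: cut_def)
    then have "\<not> (x \<in> cut S1 \<and> x \<in> cut S2 \<and> x \<in> cut S3)"
      using c[of S1] c[of S2] c[of S3] S3[OF aY(1)] S3[OF aY(2)] by blast
    then show ?thesis by auto
  qed
  then have "(\<Sum>x\<in>P. \<Sum>S\<leftarrow>[S1, S2, S3]. of_bool (x \<in> cut S)) \<le> card P * (2::nat)"
    by (rule sum_bounded_above[of P _ "2::nat", simplified])
  moreover have "(\<Sum>x\<in>P. of_bool (x \<in> cut S)) = card (cut S)" for S
  proof -
    have "P \<inter> {x. x \<in> cut S} = cut S" by (auto simp: cut_def)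
    then show ?thesis using fin(2) by (simp add: of_bool_def sum.If_cases)
  qed
  ultimately have "card (cut S1) + card (cut S2) + card (cut S3) \<le> 2 * card P"
    by (simp add: sum.distrib)
  then have "\<exists>S\<in>{S1, S2, S3}. 3 * card (cut S) \<le> 2 * card P"
    by (simp only: bex_simps) linarith
  moreover have "\<forall>S\<in>{S1, S2, S3}. S \<subseteq> Y \<and> \<bar>sum w S - sum w (Y - S)\<bar> \<le> 2 * M"
    using bal S1 M Y by (auto simp: S2_def S3_def)
  ultimately show ?thesis unfolding cut_def by blast
qed

text \<open>Class 1 is \<open>Z\<close> with vertices of \<open>X\<close> that see only
  \<open>S\<close>, class 2 is \<open>S\<close> with vertices that see only \<open>Z\<close>, and
  the remainder of \<open>X\<close> is independent and takes the colours from 3 on. The work lies in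
  showing that there are enough vertices of degree one or two to fill the first two classes.\<close>

lemma bipartite_coloring_small_side:
  fixes t :: "nat \<Rightarrow> nat"
  assumes fin: "finite X" "finite Y" and disj: "X \<inter> Y = {}" and A: "A \<subseteq> X \<times> Y"
    and edges: "card A < card X + card Y"
    and degX: "\<And>x. x \<in> X \<Longrightarrow> \<exists>y. (x, y) \<in> A"
    and degY: "\<And>y. y \<in> Y \<Longrightarrow> card {x. (x, y) \<in> A} \<le> D" and D: "1 \<le> D"
    and k: "3 \<le> k" and sum: "sum t {1..k} = card X + card Y"
    and t: "card Y \<le> t 1" "card Y \<le> t 2" "t 2 \<le> t 1"
    and bound: "6 * t 1 + 2 * card Y + 6 * D \<le> 3 * (card X + card Y)"
  shows "colorable_with_sizes A (X \<union> Y) k t"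
proof -
  define N where "N x = {y. (x, y) \<in> A}" for x
  have NY: "N x \<subseteq> Y" for x using A by (auto simp: N_def)
  have finN: "finite (N x)" for x using NY fin finite_subset by blast
  define X1 where "X1 = {x \<in> X. card (N x) = 1}"
  define X2 where "X2 = {x \<in> X. card (N x) = 2}"
  define X3 where "X3 = {x \<in> X. card (N x) \<ge> 3}"
  have f: "finite X1" "finite X2" "finite X3" using fin by (auto simp: X1_def X2_def X3_def)
  have "card (N x) \<noteq> 0" if "x \<in> X" for x
    using degX[OF that] finN[of x] by (auto simp: N_def)
  then have "card (N x) = 1 \<or> card (N x) = 2 \<or> 3 \<le> card (N x)" if "x \<in> X" for x
    using that by (metis One_nat_def Suc_1 less_2_cases linorder_not_less not_less_eq_eq numeral_3_eq_3 le_antisym)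
  then have X: "X = X1 \<union> X2 \<union> X3" by (auto simp: X1_def X2_def X3_def)
  have dj: "X1 \<inter> X2 = {}" "(X1 \<union> X2) \<inter> X3 = {}" by (auto simp: X1_def X2_def X3_def)
  have cX: "card X = card X1 + card X2 + card X3"
    unfolding X using dj f by (simp add: card_Un_disjoint)
  have "3 * card X3 \<le> (\<Sum>x\<in>X3. card (N x))"
    using sum_bounded_below[of X3 3 "\<lambda>x. card (N x)"] by (simp add: X3_def mult.commute)
  moreover have "(\<Sum>x\<in>X1. card (N x)) = card X1" "(\<Sum>x\<in>X2. card (N x)) = 2 * card X2"
    by (simp_all add: X1_def X2_def)
  moreover have "card A = (\<Sum>x\<in>X1. card (N x)) + (\<Sum>x\<in>X2. card (N x)) + (\<Sum>x\<in>X3. card (N x))"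
    using sum_card_fibers[OF fin A] dj f unfolding X by (simp add: sum.union_disjoint N_def)
  \<comment> \<open>The degrees in \<open>X\<close> exceed one by at least
    \<open>card X2 + 2 * card X3\<close> in total, and
    \<open>card A - card X < card Y\<close>.\<close>
  ultimately have n23: "card X2 + 2 * card X3 < card Y" using edges cX by linarith

  \<comment> \<open>\<open>W\<close> is chosen so that \<open>2 card (L S) = sum W S - card (cut S)\<close>: a vertex of degree two
    counts fully when both its neighbours are in \<open>S\<close>, and for half when only one is.\<close>
  define \<omega> :: "'a \<Rightarrow> int" where "\<omega> x = (if x \<in> X1 then 2 else 1)" for x
  define W where "W y = (\<Sum>x\<in>X1 \<union> X2. if (x, y) \<in> A then \<omega> x else 0)" for y
  define L where "L S = {x \<in> X1 \<union> X2. N x \<subseteq> S}" for S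
  define cut where "cut S = {x \<in> X2. card (N x \<inter> S) = 1}" for S
  have W: "sum W S = 2 * int (card (L S)) + int (card (cut S))" if S: "S \<subseteq> Y" for S
  proof -
    have fS: "finite S" using S fin finite_subset by blast
    have "sum W S = (\<Sum>x\<in>X1 \<union> X2. \<Sum>y\<in>S. if (x, y) \<in> A then \<omega> x else 0)"
      unfolding W_def by (rule sum.swap)
    also have "\<dots> = (\<Sum>x\<in>X1 \<union> X2. 2 * of_bool (x \<in> L S) + of_bool (x \<in> cut S))"
    proof (rule sum.cong[OF refl])
      fix x assume x: "x \<in> X1 \<union> X2"
      have "(\<Sum>y\<in>S. if (x, y) \<in> A then \<omega> x else 0) = \<omega> x * int (card (N x \<inter> S))"
        using fS by (simp add: sum.If_cases N_def Int_commute)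
      also have "\<dots> = 2 * of_bool (x \<in> L S) + of_bool (x \<in> cut S)"
      proof (cases "x \<in> X1")
        case True
        then obtain a where "N x = {a}" by (auto simp: X1_def card_1_singleton_iff)
        moreover have "x \<notin> X2" using True dj by auto
        ultimately show ?thesis using True by (auto simp: \<omega>_def L_def cut_def Int_insert_left)
      next
        case False
        then have x2: "x \<in> X2" using x by auto
        then obtain a b where "N x = {a, b}" "a \<noteq> b" by (auto simp: X2_def card_2_iff)
        then show ?thesis using False x2 by (auto simp: \<omega>_def L_def cut_def Int_insert_left)
      qed
      finally show "(\<Sum>y\<in>S. if (x, y) \<in> A then \<omega> x else 0) = \<dots>" .
    qed
    also have "\<dots> = 2 * int (card (L S)) + int (card (cut S))"
    proof -
      have "(X1 \<union> X2) \<inter> L S = L S" "(X1 \<union> X2) \<inter> cut S = cut S"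
        by (auto simp: L_def cut_def)
      then show ?thesis
        using f by (simp add: sum.distrib sum_distrib_left[symmetric] of_bool_def sum.If_cases)
    qed
    finally show ?thesis .
  qed
  have W0: "0 \<le> W y \<and> W y \<le> 2 * int D" if "y \<in> Y" for y
  proof -
    have fy: "finite {x. (x, y) \<in> A}" by (rule finite_subset[OF _ fin(1)]) (use A in auto)
    have "W y = (\<Sum>x\<in>(X1 \<union> X2) \<inter> {x. (x, y) \<in> A}. \<omega> x)"
      unfolding W_def using f by (simp add: sum.If_cases)
    also have "\<dots> \<le> int (card ((X1 \<union> X2) \<inter> {x. (x, y) \<in> A})) * 2"
      by (rule sum_bounded_above) (simp add: \<omega>_def)
    also have "card ((X1 \<union> X2) \<inter> {x. (x, y) \<in> A}) \<le> D"
      using degY[OF that] card_mono[OF fy, of "(X1 \<union> X2) \<inter> {x. (x, y) \<in> A}"] by auto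
    finally have "W y \<le> 2 * int D" by simp
    moreover have "0 \<le> W y" unfolding W_def by (rule sum_nonneg) (simp add: \<omega>_def)
    ultimately show ?thesis by simp
  qed
  have "N x \<subseteq> Y \<and> card (N x) = 2" if "x \<in> X2" for x using that NY by (auto simp: X2_def)
  \<comment> \<open>The quantities to be balanced are \<open>card (L S) + card Z\<close> and
    \<open>card (L Z) + card S\<close>. Twice their difference is the difference of the sums of
    \<open>W y - 2\<close> over \<open>S\<close> and \<open>Z\<close>, since the cut contributes
    equally to both sides. By \<open>W0\<close> and \<open>D \<ge> 1\<close> the shifted weights are
    bounded by \<open>2 * D\<close>.\<close>
  then obtain S where S: "S \<subseteq> Y" and
    bal: "\<bar>sum (\<lambda>y. W y - 2) S - sum (\<lambda>y. W y - 2) (Y - S)\<bar> \<le> 2 * (2 * int D)"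
    and cutS: "3 * card (cut S) \<le> 2 * card X2"
    using exists_split_with_small_cut[of Y X2 "\<lambda>y. W y - 2" "2 * int D" N] fin f W0 D
    unfolding cut_def by fastforce
  define Z where "Z = Y - S"
  have fSZ: "finite S" "finite Z" "S \<inter> Z = {}" "Y = S \<union> Z" using fin S by (auto simp: Z_def intro: finite_subset)
  have cY: "card Y = card S + card Z" using fSZ by (simp add: card_Un_disjoint)
  have LY: "L Y = X1 \<union> X2" using NY by (auto simp: L_def)
  have cutY: "cut Y = {}" using NY by (auto simp: cut_def X2_def Int_absorb2)
  have "sum W Y = 2 * int (card X1 + card X2)"
    using W[of Y] dj f by (simp add: LY cutY card_Un_disjoint)
  then have sumW: "sum W S + sum W Z = 2 * int (card X1 + card X2)"
    using fSZ by (simp add: sum.union_disjoint)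
  have cutZ: "cut Z = cut S"
  proof -
    have "card (N x \<inter> S) + card (N x \<inter> Z) = card (N x)" for x
    proof -
      have "N x = (N x \<inter> S) \<union> (N x \<inter> Z)" using NY[of x] fSZ by auto
      moreover have "(N x \<inter> S) \<inter> (N x \<inter> Z) = {}" using fSZ by auto
      ultimately show ?thesis using finN by (metis card_Un_disjoint finite_Int)
    qed
    then have "card (N x \<inter> Z) = 1 \<longleftrightarrow> card (N x \<inter> S) = 1" if "x \<in> X2" for x
      using that by (smt (verit) X2_def mem_Collect_eq add_diff_cancel_left' add_diff_cancel_right' one_add_one)
    then show ?thesis by (auto simp: cut_def)
  qed
  have "sum W S = 2 * int (card (L S)) + int (card (cut S))"
    "sum W Z = 2 * int (card (L Z)) + int (card (cut S))"
    using W[of S] W[of Z] S cutZ by (auto simp: Z_def)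
  \<comment> \<open>The numbers \<open>card (L S) + card Z\<close> and
    \<open>card (L Z) + card S\<close> add up to
    \<open>card X1 + card X2 + card Y - card (cut S)\<close> and differ by at most
    \<open>2 * D\<close>. With \<open>cutS\<close> and \<open>n23\<close>, six times either of them
    is at least \<open>3 * card X + card Y - 6 * D\<close>, which is at least \<open>6 * t 1\<close>
    by \<open>bound\<close>.\<close>
  then have "6 * int (card (L S)) + 6 * int (card Z) \<ge> 6 * int (t 1) \<and>
      6 * int (card (L Z)) + 6 * int (card S) \<ge> 6 * int (t 1)"
    using bal sumW cutS n23 cX cY bound
    unfolding Z_def[symmetric] sum_subtractf sum_constant by simp linarith
  then have L: "t 1 - card Z \<le> card (L S)" "t 2 - card S \<le> card (L Z)"
    using t by linarith+
  obtain L1 where L1: "L1 \<subseteq> L S" "card L1 = t 1 - card Z" using L(1) by (meson obtain_subset_with_card_n)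
  obtain L2 where L2: "L2 \<subseteq> L Z" "card L2 = t 2 - card S" using L(2) by (meson obtain_subset_with_card_n)
  have LX: "L S \<subseteq> X" "L Z \<subseteq> X" by (auto simp: L_def X1_def X2_def)
  have fL: "finite L1" "finite L2" using L1 L2 LX fin by (meson finite_subset)+
  have NE: "N x \<noteq> {}" if "x \<in> X" for x using degX[OF that] by (auto simp: N_def)
  \<comment> \<open>A vertex that sees only \<open>S\<close> and also only \<open>Z\<close> would
    have no neighbour at all.\<close>
  have LL: "L S \<inter> L Z = {}"
  proof -
    have "N x \<subseteq> S \<inter> Z" if "x \<in> L S \<inter> L Z" for x using that by (auto simp: L_def)
    then show ?thesis using NE LX fSZ(3) by blast
  qed
  have c1: "card (Z \<union> L1) = t 1" and c2: "card (S \<union> L2) = t 2"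
  proof -
    have "Z \<inter> L1 = {}" "S \<inter> L2 = {}" using L1 L2 LX disj fSZ by auto
    then show "card (Z \<union> L1) = t 1" "card (S \<union> L2) = t 2"
      using fL fSZ L1 L2 t cY by (simp_all add: card_Un_disjoint)
  qed
  define P where "P = X - L1 - L2"
  have "{1..k} = {1, 2} \<union> {3..k}" using k by auto
  then have "sum t {1..k} = t 1 + t 2 + sum t {3..k}" by (simp add: sum.union_disjoint)
  moreover have V: "X \<union> Y = P \<union> {} \<union> (Z \<union> L1 \<union> (S \<union> L2))"
    using L1 L2 LX fSZ by (auto simp: P_def)
  moreover have dZS: "(Z \<union> L1) \<inter> (S \<union> L2) = {}"
    using L1 L2 LL LX disj fSZ by auto
  moreover have dP: "P \<inter> (Z \<union> L1 \<union> (S \<union> L2)) = {}"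
    using disj fSZ by (auto simp: P_def)
  moreover have "card (X \<union> Y) = card X + card Y" using fin disj by (simp add: card_Un_disjoint)
  moreover have "finite P" using fin by (simp add: P_def)
  ultimately have cP: "card P = sum t {3..k}"
    using sum c1 c2 fSZ fL by (simp add: card_Un_disjoint)
  define c0 :: "'a \<Rightarrow> nat" where "c0 v = (if v \<in> Z \<union> L1 then 1 else 2)" for v
  have "colorable_with_sizes A (P \<union> {} \<union> (Z \<union> L1 \<union> (S \<union> L2))) k t"
  proof (rule colorable_with_sizesI[where ?c0.0 = c0 and ?I0.0 = "{1, 2}" and IP = "{3..k}" and IQ = "{}"])
    show "A \<subseteq> (P \<union> {} \<union> (Z \<union> L1 \<union> (S \<union> L2))) \<times> (P \<union> {} \<union> (Z \<union> L1 \<union> (S \<union> L2)))"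
      using A unfolding V[symmetric] by auto
    show "card {v \<in> Z \<union> L1 \<union> (S \<union> L2). c0 v = i} = t i" if "i \<in> {1, 2}" for i
    proof -
      have "{v \<in> Z \<union> L1 \<union> (S \<union> L2). c0 v = 1} = Z \<union> L1" "{v \<in> Z \<union> L1 \<union> (S \<union> L2). c0 v = 2} = S \<union> L2"
        using dZS by (auto simp: c0_def)
      then show ?thesis using that c1 c2 by auto
    qed
    show "\<not> (x \<in> P \<and> y \<in> P) \<and> \<not> (x \<in> {} \<and> y \<in> {})" if "(x, y) \<in> A" for x y
      using that A disj by (auto simp: P_def)
    show "c0 x \<noteq> c0 y" if "(x, y) \<in> A" and x: "x \<in> Z \<union> L1 \<union> (S \<union> L2)" and "y \<in> Z \<union> L1 \<union> (S \<union> L2)" for x y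
    proof -
      have xy: "x \<in> X" "y \<in> Y" "y \<in> N x" using that A by (auto simp: N_def)
      then consider "x \<in> L1" | "x \<in> L2" using x disj fSZ by blast
      then show ?thesis
      proof cases
        case 1
        then have "y \<in> S" using xy L1 by (auto simp: L_def)
        then show ?thesis using 1 dZS by (auto simp: c0_def)
      next
        case 2
        then have "y \<in> Z" using xy L2 by (auto simp: L_def)
        then show ?thesis using 2 dZS by (auto simp: c0_def)
      qed
    qed
    show "{1, 2} \<union> {3..k} \<union> {} = {1..k}" using k by auto
  qed (use cP dP fSZ fL fin in \<open>auto simp: P_def c0_def\<close>)
  then show ?thesis by (simp add: V)
qed

section \<open>Rooted trees as parent functions\<close>

text \<open>\<open>d\<close> is the depth up to an additive constant, as \<open>d r\<close> is not
  fixed; its growth away from the root is what excludes cycles. The convention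
  \<open>p r = r\<close> matches the later treatment of the root in \<open>shape\<close>.\<close>

locale rooted_tree =
  fixes V :: "'a set" and r :: 'a and p :: "'a \<Rightarrow> 'a" and d :: "'a \<Rightarrow> nat" and E :: "'a set set"
  assumes finite_V: "finite V" and root: "r \<in> V" and p_root: "p r = r"
    and p_in: "\<And>v. v \<in> V \<Longrightarrow> v \<noteq> r \<Longrightarrow> p v \<in> V"
    and d_p: "\<And>v. v \<in> V \<Longrightarrow> v \<noteq> r \<Longrightarrow> d v = Suc (d (p v))"
    and E: "E = (\<lambda>v. {v, p v}) ` (V - {r})"
begin

definition children :: "'a \<Rightarrow> 'a set" where
  "children v = {u \<in> V - {r}. p u = v}"

lemma edge_iff: "{u, v} \<in> E \<longleftrightarrow> u \<in> children v \<or> v \<in> children u"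
  unfolding E children_def by (auto simp: doubleton_eq_iff)

lemma childrenD: "u \<in> children v \<Longrightarrow> u \<in> V \<and> u \<noteq> r \<and> v \<in> V \<and> d u = Suc (d v) \<and> p u = v"
  using p_in d_p by (auto simp: children_def)

lemma child_of_parent: "v \<in> V \<Longrightarrow> v \<noteq> r \<Longrightarrow> v \<in> children (p v)"
  by (simp add: children_def)

lemma finite_children: "finite (children v)"
  using finite_V by (simp add: children_def)

lemma edgeD: "{u, v} \<in> E \<Longrightarrow> u \<in> V \<and> v \<in> V \<and> u \<noteq> v"
  using edge_iff childrenD by force

lemma neighbors_eq: "{w. {v, w} \<in> E} = children v \<union> (if v \<in> V \<and> v \<noteq> r then {p v} else {})"
  unfolding edge_iff by (auto simp: children_def)

lemma card_E: "Suc (card E) = card V"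
proof -
  have "inj_on (\<lambda>v. {v, p v}) (V - {r})"
  proof (rule inj_onI)
    fix u v assume uv: "u \<in> V - {r}" "v \<in> V - {r}" "{u, p u} = {v, p v}"
    show "u = v"
    proof (rule ccontr)
      assume "u \<noteq> v"
      with uv(3) have "u = p v" "v = p u" by (auto simp: doubleton_eq_iff)
      then have "d u = Suc (d v)" "d v = Suc (d u)" using uv d_p by (metis Diff_iff singletonI)+
      then show False by simp
    qed
  qed
  then have "card E = card (V - {r})" unfolding E by (rule card_image)
  then show ?thesis using finite_V root by (metis card.remove)
qed

lemma connected_to_root:
  assumes "v \<in> V" shows "(v, r) \<in> {(x, y). {x, y} \<in> E}\<^sup>*"
  using assms
proof (induction "d v" arbitrary: v rule: less_induct)
  case less
  show ?case
  proof (cases "v = r")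
    case False
    then have "{v, p v} \<in> E" "(p v, r) \<in> {(x, y). {x, y} \<in> E}\<^sup>*"
      using less d_p p_in by (auto simp: E)
    then show ?thesis by (auto intro: converse_rtrancl_into_rtrancl)
  qed simp
qed

lemma is_tree: "is_tree (V, E)"
  unfolding is_tree_def
proof (intro conjI notI)
  show "simple_graph (V, E)"
    unfolding simple_graph_def nsets_def using finite_V p_in d_p
    by (auto simp: E card_insert_if) (metis n_not_Suc_n)
  let ?R = "{(x, y). {x, y} \<in> E}"
  have "sym ?R" by (auto simp: sym_def insert_commute)
  then have "(r, v) \<in> ?R\<^sup>*" if "v \<in> V" for v
    using connected_to_root[OF that] by (metis sym_rtrancl symD)
  then show "graph_connected (V, E)"
    unfolding graph_connected_def using root connected_to_root by (auto intro: rtrancl_trans)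
  assume "\<exists>q. graph_cycle (V, E) q"
  then obtain q where q: "3 \<le> length q" "distinct q"
      "\<And>i. i < length q \<Longrightarrow> {q ! i, q ! (Suc i mod length q)} \<in> E"
    by (auto simp: graph_cycle_def)
  \<comment> \<open>Take a vertex of maximal depth on the cycle. Both its neighbours there are no
    deeper, so both are its parent, although they are distinct in a cycle of length at least
    three.\<close>
  have "set q \<noteq> {}" using q(1) by auto
  then have "Max (d ` set q) \<in> d ` set q" by (intro Max_in) auto
  then obtain v where v: "v \<in> set q" "d v = Max (d ` set q)" by auto
  then obtain i where "i < length q" "q ! i = v" by (auto simp: in_set_conv_nth)
  with v have i: "i < length q" "\<And>j. j < length q \<Longrightarrow> d (q ! j) \<le> d (q ! i)" by auto
  define j where "j = (if i = 0 then length q - 1 else i - 1)"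
  have j: "j < length q" "Suc j mod length q = i" using i q(1) by (auto simp: j_def)
  let ?k = "Suc i mod length q"
  have k: "?k < length q" using i by (intro mod_less_divisor) linarith
  have par: "w = p v" if "{v, w} \<in> E" "d w \<le> d v" for v w
    using that childrenD[of w v] childrenD[of v w] by (auto simp: edge_iff)
  have "q ! j = p (q ! i)"
    using par[of "q ! i" "q ! j"] q(3)[OF j(1)] i(2)[OF j(1)] j(2) by (simp add: insert_commute)
  moreover have "q ! ?k = p (q ! i)"
    using par[of "q ! i" "q ! ?k"] q(3)[OF i(1)] i(2)[OF k] by simp
  ultimately have "j = ?k" using q(2) j(1) k by (metis nth_eq_iff_index_eq)
  then show False using q(1) i by (auto simp: j_def mod_Suc split: if_splits)
qed

end

section \<open>From trees as graphs to parent functions\<close>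

lemma path_of_rtrancl:
  assumes "(a, b) \<in> {(x, y). {x, y} \<in> F}\<^sup>*"
  shows "\<exists>xs. xs \<noteq> [] \<and> hd xs = a \<and> last xs = b \<and> distinct xs \<and> successively (\<lambda>x y. {x, y} \<in> F) xs"
  using assms
proof (induction rule: converse_rtrancl_induct)
  case base
  then show ?case by (intro exI[of _ "[b]"]) simp
next
  case (step a y)
  then obtain xs where xs: "xs \<noteq> []" "hd xs = y" "last xs = b" "distinct xs"
    "successively (\<lambda>x y. {x, y} \<in> F) xs" by blast
  show ?case
  proof (cases "a \<in> set xs")
    case True
    \<comment> \<open>The path from \<open>y\<close> passes through \<open>a\<close>; its part from
      there on is already a path from \<open>a\<close> to \<open>b\<close>.\<close>
    then obtain ys zs where "xs = ys @ a # zs" by (meson split_list)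
    then show ?thesis
      using xs by (intro exI[of _ "a # zs"]) (auto simp: successively_append_iff)
  next
    case False
    then show ?thesis
      using xs step by (intro exI[of _ "a # xs"]) (auto simp: successively_Cons)
  qed
qed

text \<open>A simple path from \<open>a\<close> to \<open>b\<close> in \<open>F\<close> is closed to
  a cycle by the edge \<open>{a, b}\<close>. It has at least three vertices because this edge is not
  in \<open>F\<close>.\<close>

lemma ex_cycle_if_connected_without_edge:
  assumes ab: "{a, b} \<in> snd G" "{a, b} \<notin> F" "a \<noteq> b" and F: "F \<subseteq> snd G"
    and conn: "(a, b) \<in> {(x, y). {x, y} \<in> F}\<^sup>*"
  shows "\<exists>q. graph_cycle G q"
proof -
  obtain xs where xs: "xs \<noteq> []" "hd xs = a" "last xs = b" "distinct xs"
    "successively (\<lambda>x y. {x, y} \<in> F) xs" using path_of_rtrancl[OF conn] by blast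
  have "3 \<le> length xs"
  proof (rule ccontr)
    assume "\<not> 3 \<le> length xs"
    then have "length xs = 0 \<or> length xs = 1 \<or> length xs = 2" by linarith
    then show False using xs ab by (auto simp: length_Suc_conv numeral_2_eq_2)
  qed
  moreover have "{xs ! i, xs ! (Suc i mod length xs)} \<in> snd G" if i: "i < length xs" for i
  proof (cases "Suc i < length xs")
    case True
    then have "{xs ! i, xs ! Suc i} \<in> F" using xs(5) by (auto simp: successively_conv_nth)
    then show ?thesis using True F by auto
  next
    case False
    then have *: "Suc i = length xs" using i by simp
    then have "i = length xs - 1" by simp
    then have "xs ! i = b" using xs(1,3) by (simp add: last_conv_nth)
    moreover have "xs ! (Suc i mod length xs) = a" unfolding * using xs(1,2) by (simp add: hd_conv_nth)
    ultimately show ?thesis using ab by (simp add: insert_commute)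
  qed
  ultimately show ?thesis using xs(4) by (auto simp: graph_cycle_def)
qed

text \<open>Let \<open>d\<close> be the distance from \<open>r\<close> and let the parent of a
  vertex be a neighbour one step closer. The parent edges \<open>F\<close> already connect
  everything, so a further edge of \<open>G\<close> would close a cycle.\<close>

lemma rooted_tree_of_is_tree:
  assumes G: "is_tree G" and r: "r \<in> fst G"
  shows "\<exists>p d. rooted_tree (fst G) r p d (snd G)"
proof -
  have sG: "simple_graph G" and cG: "graph_connected G" and aG: "\<nexists>q. graph_cycle G q"
    using G by (auto simp: is_tree_def)
  let ?V = "fst G" and ?E = "snd G"
  let ?R = "{(x, y). {x, y} \<in> ?E}"
  define d where "d v = (LEAST n. (r, v) \<in> ?R ^^ n)" for v
  have dle: "d v \<le> n" if "(r, v) \<in> ?R ^^ n" for v n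
    unfolding d_def using that by (rule Least_le)
  have din: "(r, v) \<in> ?R ^^ d v" if "v \<in> ?V" for v
  proof -
    have "(r, v) \<in> ?R\<^sup>*" using cG r that by (simp add: graph_connected_def)
    then obtain n where "(r, v) \<in> ?R ^^ n" by (meson rtrancl_imp_relpow)
    then show ?thesis unfolding d_def by (rule LeastI)
  qed
  have "\<exists>u\<in>?V. {u, v} \<in> ?E \<and> d v = Suc (d u)" if v: "v \<in> ?V" "v \<noteq> r" for v
  proof -
    obtain m where m: "d v = Suc m" using din[OF v(1)] v(2) by (cases "d v") auto
    then obtain u where u: "(r, u) \<in> ?R ^^ m" "{u, v} \<in> ?E"
      using din[OF v(1)] by auto
    have uV: "u \<in> ?V" using simple_graph_edgeD[OF sG u(2)] by simp
    have "(r, v) \<in> ?R ^^ Suc (d u)" using din[OF uV] u(2) by auto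
    then show ?thesis using dle[OF u(1)] dle[of v "Suc (d u)"] m u(2) uV by force
  qed
  then obtain p where p: "\<And>v. v \<in> ?V \<Longrightarrow> v \<noteq> r \<Longrightarrow> p v \<in> ?V \<and> {p v, v} \<in> ?E \<and> d v = Suc (d (p v))"
    by metis
  define p' where "p' v = (if v = r then r else p v)" for v
  define F where "F = (\<lambda>v. {v, p' v}) ` (?V - {r})"
  interpret F: rooted_tree ?V r p' d F
    using sG r p by unfold_locales (auto simp: p'_def F_def simple_graph_def)
  have FE: "F \<subseteq> ?E" using p by (auto simp: F_def p'_def insert_commute)
  have "e \<in> F" if e: "e \<in> ?E" for e
  proof (rule ccontr)
    assume "e \<notin> F"
    obtain a b where ab: "e = {a, b}" "a \<in> ?V" "b \<in> ?V" "a \<noteq> b"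
      using simple_graph_edgeE[OF sG e] .
    have "(a, b) \<in> {(x, y). {x, y} \<in> F}\<^sup>*"
      using F.is_tree ab by (auto simp: is_tree_def graph_connected_def)
    then have "\<exists>q. graph_cycle G q"
      using ex_cycle_if_connected_without_edge[of a b G F] ab \<open>e \<notin> F\<close> e FE by auto
    then show False using aG by simp
  qed
  then have "F = ?E" using FE by auto
  then show ?thesis using F.rooted_tree_axioms by metis
qed

section \<open>Trees of small degree are strongly balanced\<close>

definition vertex_degree :: "'a sgraph \<Rightarrow> 'a \<Rightarrow> nat" where
  "vertex_degree G v = card {w. {v, w} \<in> snd G}"

lemma strongly_balancedI:
  assumes "colorable_with_sizes A (fst G) k t" and "\<And>u v. {u, v} \<in> snd G \<Longrightarrow> (u, v) \<in> A \<or> (v, u) \<in> A"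
    and "\<And>i. i \<in> {1..k} \<Longrightarrow> s \<le> t i \<and> t i \<le> Suc s"
  shows "strongly_balanced k G"
proof -
  obtain c where c: "c \<in> fst G \<rightarrow> {1..k}" "\<forall>(x, y)\<in>A. c x \<noteq> c y"
    "\<forall>i\<in>{1..k}. card {v \<in> fst G. c v = i} = t i"
    using assms(1) by (auto simp: colorable_with_sizes_def)
  have "\<bar>int (t i) - int (t j)\<bar> \<le> 1" if "i \<in> {1..k}" "j \<in> {1..k}" for i j
    using assms(3)[OF that(1)] assms(3)[OF that(2)] by linarith
  moreover have "c u \<noteq> c v" if "{u, v} \<in> snd G" for u v
    using assms(2)[OF that] c(2) by auto
  ultimately show ?thesis
    unfolding strongly_balanced_def using c(1,3) by (intro bexI[of _ c]) auto
qed

lemma sum_equitable_sizes: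
  fixes n k :: nat
  assumes "1 \<le> k"
  shows "(\<Sum>i\<in>{1..k}. n div k + of_bool (i \<le> n mod k)) = n"
proof -
  have "n mod k < k" using assms by simp
  then have "{1..k} \<inter> {i. i \<le> n mod k} = {1..n mod k}" by auto
  then show ?thesis using assms by (simp add: sum.distrib of_bool_def sum.If_cases)
qed

text \<open>The sizes \<open>t\<close> are equitable with the larger ones first, so
  \<open>t 1\<close> is the maximum. Whether class 1 fits into the smaller side \<open>Y\<close>
  decides between the two colouring lemmas.\<close>

lemma strongly_balanced_of_bipartition:
  assumes sG: "simple_graph G" and V: "fst G = X \<union> Y" "X \<inter> Y = {}"
    and bip: "\<And>u v. {u, v} \<in> snd G \<Longrightarrow> u \<in> X \<longleftrightarrow> v \<in> Y"
    and edges: "card (snd G) < card (fst G)"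
    and deg0: "\<And>v. v \<in> fst G \<Longrightarrow> \<exists>w. {v, w} \<in> snd G"
    and deg: "\<And>v. v \<in> fst G \<Longrightarrow> 36 * vertex_degree G v < card (fst G)"
    and k: "3 \<le> k" "k \<le> card (fst G)" and n: "36 < card (fst G)"
    and le: "card Y \<le> card X"
  shows "strongly_balanced k G"
proof -
  define n where "n = card (fst G)"
  define A where "A = {(x, y). x \<in> X \<and> y \<in> Y \<and> {x, y} \<in> snd G}"
  define t where "t i = n div k + of_bool (i \<le> n mod k)" for i
  have fin: "finite X" "finite Y" using sG V by (auto simp: simple_graph_def)
  have nXY: "n = card X + card Y" using V fin by (simp add: n_def card_Un_disjoint)
  have finE: "finite (snd G)"
    using sG by (auto simp: simple_graph_def nsets_def intro: finite_subset[of _ "Pow (fst G)"])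
  have "inj_on (\<lambda>(x, y). {x, y}) A" using V(2) by (auto simp: inj_on_def A_def doubleton_eq_iff)
  then have "card A \<le> card (snd G)"
    by (rule card_inj_on_le) (auto simp: A_def finE)
  then have cA: "card A < card X + card Y" using edges nXY by (simp add: n_def)
  have AXY: "A \<subseteq> X \<times> Y" by (auto simp: A_def)
  have sumt: "sum t {1..k} = card X + card Y"
    using sum_equitable_sizes[of k n] k by (simp add: t_def nXY)
  have div: "1 \<le> n div k" using k by (simp add: n_def div_greater_zero_iff Suc_le_eq)
  have "colorable_with_sizes A (X \<union> Y) k t"
  proof (cases "t 1 \<le> card Y")
    case True
    then show ?thesis
      using fin V AXY cA le k sumt div
      by (intro bipartite_coloring_large_side) (auto simp: t_def)
  next
    case False
    \<comment> \<open>The largest number with \<open>36 * D < n\<close>, hence a bound on all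
      degrees.\<close>
    define D where "D = (n - 1) div 36"
    have "n div k \<le> n div 3" using k by (intro div_le_mono2) auto
    then have b: "3 * (n div k) \<le> n" by linarith
    have t1: "t 1 \<le> n div k + 1" by (simp add: t_def)
    have Yn: "card Y \<le> n div k" using False t1 by linarith
    have D: "36 * D \<le> n" "1 \<le> D" using n by (auto simp: D_def n_def)
    show ?thesis
    proof (rule bipartite_coloring_small_side[where D = D])
      fix y assume y: "y \<in> Y"
      have "finite {w. {y, w} \<in> snd G}"
        by (rule finite_subset[of _ "fst G"]) (use sG simple_graph_edgeD(2)[OF sG] in \<open>auto simp: simple_graph_def\<close>)
      then have "card {x. (x, y) \<in> A} \<le> vertex_degree G y"
        unfolding vertex_degree_def by (intro card_mono) (auto simp: A_def insert_commute)
      also have "\<dots> \<le> D" using deg[of y] y V by (simp add: D_def n_def)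
      finally show "card {x. (x, y) \<in> A} \<le> D" .
    next
      \<comment> \<open>The terms are at most \<open>2 * n + 6\<close>, \<open>2 * n / 3\<close> and
        \<open>n / 6\<close>. They add up to \<open>17 * n / 6 + 6\<close>, which is at most
        \<open>3 * n\<close> for \<open>n \<ge> 36\<close>.\<close>
      show "6 * t 1 + 2 * card Y + 6 * D \<le> 3 * (card X + card Y)"
        using b t1 Yn D n unfolding nXY[symmetric] n_def[symmetric] by linarith
    next
      fix x assume x: "x \<in> X"
      then obtain w where "{x, w} \<in> snd G" using deg0[of x] V by auto
      then show "\<exists>y. (x, y) \<in> A" using bip x by (auto simp: A_def)
    qed (use fin V AXY cA k sumt Yn D in \<open>auto simp: t_def\<close>)
  qed
  then show ?thesis
    unfolding V(1)[symmetric]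
  proof (rule strongly_balancedI[where s = "n div k"])
    fix u v assume "{u, v} \<in> snd G"
    then show "(u, v) \<in> A \<or> (v, u) \<in> A"
      using bip[of u v] bip[of v u] simple_graph_edgeD[OF sG, of u v] V
      by (auto simp: A_def insert_commute)
  qed (auto simp: t_def)
qed

text \<open>The parity of the depth gives the bipartition. Either parity may be the larger side,
  hence two symmetric cases.\<close>

lemma strongly_balanced_if_small_degrees:
  assumes G: "is_tree G" and k: "3 \<le> k" "k \<le> card (fst G)" and n: "36 < card (fst G)"
    and deg: "\<And>v. v \<in> fst G \<Longrightarrow> 36 * vertex_degree G v < card (fst G)"
  shows "strongly_balanced k G"
proof -
  have sG: "simple_graph G" and ne: "fst G \<noteq> {}"
    using G by (auto simp: is_tree_def graph_connected_def)
  then obtain r where r: "r \<in> fst G" by auto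
  obtain p d where "rooted_tree (fst G) r p d (snd G)"
    using rooted_tree_of_is_tree[OF G r] by blast
  then interpret rooted_tree "fst G" r p d "snd G" .
  define X where "X = {v \<in> fst G. even (d v)}"
  define Y where "Y = {v \<in> fst G. odd (d v)}"
  have bip: "u \<in> X \<longleftrightarrow> v \<in> Y" if "{u, v} \<in> snd G" for u v
    using that childrenD[of u v] childrenD[of v u] by (auto simp: edge_iff X_def Y_def)
  have deg0: "\<exists>w. {v, w} \<in> snd G" if v: "v \<in> fst G" for v
  proof -
    have "\<not> fst G \<subseteq> {v}"
      using n card_mono[of "{v}" "fst G"] by auto
    then obtain u where u: "u \<in> fst G" "u \<noteq> v" by auto
    have "(v, u) \<in> {(x, y). {x, y} \<in> snd G}\<^sup>*"
      using G v u by (auto simp: is_tree_def graph_connected_def)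
    then show ?thesis using u(2) by (auto elim: converse_rtranclE)
  qed
  have XY: "fst G = X \<union> Y" "X \<inter> Y = {}" "fst G = Y \<union> X" "Y \<inter> X = {}"
    by (auto simp: X_def Y_def)
  have edges: "card (snd G) < card (fst G)" using card_E by simp
  have bip': "u \<in> Y \<longleftrightarrow> v \<in> X" if "{u, v} \<in> snd G" for u v
    using bip[of v u] that by (simp add: insert_commute)
  show ?thesis
  proof (cases "card Y \<le> card X")
    case True
    show ?thesis
      by (rule strongly_balanced_of_bipartition[OF sG XY(1,2) bip edges deg0 deg k n True])
  next
    case False
    then show ?thesis
      by (intro strongly_balanced_of_bipartition[OF sG XY(3,4) bip' edges deg0 deg k n]) auto
  qed
qed

section \<open>Unlabeled rooted trees with large root degree\<close>

text \<open>Since the branches form a multiset, equality of such trees is isomorphism of unlabeled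
  rooted trees.\<close>

datatype rtree = Node (subtrees: "rtree multiset")

primrec nodes :: "rtree \<Rightarrow> nat" where
  "nodes (Node M) = Suc (\<Sum>\<^sub># (image_mset nodes M))"

lemma nodes_pos: "0 < nodes t"
  by (cases t) simp

lemma nodes_eq: "nodes t = Suc (\<Sum>\<^sub># (image_mset nodes (subtrees t)))"
  by (cases t) simp

lemma size_le_sum_nodes: "size M \<le> \<Sum>\<^sub># (image_mset nodes M)"
proof (induction M)
  case (add t M)
  then show ?case using nodes_pos[of t] by simp
qed simp

lemma nodes_le_sum: "t \<in># M \<Longrightarrow> nodes t \<le> \<Sum>\<^sub># (image_mset nodes M)"
  by (metis image_mset_add_mset le_add1 mset_add sum_mset.add_mset)

lemma sum_nodes_set_le: "(\<Sum>t\<in>set_mset M. nodes t) \<le> \<Sum>\<^sub># (image_mset nodes M)"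
proof (induction M)
  case (add t M)
  then show ?case by (cases "t \<in># M") (auto simp: insert_absorb)
qed simp

definition rtrees :: "nat \<Rightarrow> rtree set" where
  "rtrees n = {t. nodes t = n}"

lemma finite_nodes_le: "finite {t. nodes t \<le> n}"
proof (induction n)
  case 0
  have "{t. nodes t \<le> 0} = {}" using nodes_pos by (auto simp: not_le)
  then show ?case by (simp del: le_zero_eq)
next
  case (Suc n)
  let ?L = "{xs. set xs \<subseteq> {t. nodes t \<le> n} \<and> length xs \<le> n}"
  have "{t. nodes t \<le> Suc n} \<subseteq> (\<lambda>xs. Node (mset xs)) ` ?L"
  proof
    fix t assume t: "t \<in> {t. nodes t \<le> Suc n}"
    obtain xs where xs: "subtrees t = mset xs" by (metis ex_mset)
    have "\<Sum>\<^sub># (image_mset nodes (mset xs)) \<le> n" using t nodes_eq[of t] xs by simp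
    then have "xs \<in> ?L" using size_le_sum_nodes[of "mset xs"] nodes_le_sum[of _ "mset xs"] by force
    moreover have "t = Node (mset xs)" using xs by (cases t) simp
    ultimately show "t \<in> (\<lambda>xs. Node (mset xs)) ` ?L" by blast
  qed
  moreover have "finite ?L" using finite_lists_length_le[OF Suc.IH] .
  ultimately show ?case by (meson finite_imageI finite_subset)
qed

lemma finite_rtrees: "finite (rtrees n)"
  by (rule finite_subset[OF _ finite_nodes_le[of n]]) (auto simp: rtrees_def)

text \<open>Branches of equal shape count once, and the sizes of the distinct ones add up to less
  than \<open>nodes t\<close>. So a bound by \<open>nodes\<close> passes from the branches to the
  whole tree.\<close>

lemma card_descents_le:
  assumes "\<And>a. finite (A a)" "\<And>a. card (A a) \<le> nodes a"
  shows "card (SIGMA a:set_mset (subtrees t). A a) \<le> nodes t"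
proof -
  have "card (SIGMA a:set_mset (subtrees t). A a) = (\<Sum>a\<in>set_mset (subtrees t). card (A a))"
    using assms by simp
  also have "\<dots> \<le> (\<Sum>a\<in>set_mset (subtrees t). nodes a)" using assms by (intro sum_mono)
  also have "\<dots> \<le> nodes t" using sum_nodes_set_le[of "subtrees t"] nodes_eq[of t] by simp
  finally show ?thesis .
qed

text \<open>Paths of three steps down from the root, recorded by the shapes met. A path is
  determined by its end, which is why there are at most \<open>nodes t\<close> of them.\<close>

definition descents :: "rtree \<Rightarrow> (rtree \<times> rtree \<times> rtree) set" where
  "descents t = (SIGMA a:set_mset (subtrees t). SIGMA b:set_mset (subtrees a). set_mset (subtrees b))"

lemma card_descents: "card (descents t) \<le> nodes t"
  unfolding descents_def
proof (rule card_descents_le)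
  fix a
  have "card (set_mset (subtrees b)) \<le> nodes b" for b
    using sum_bounded_below[of "set_mset (subtrees b)" 1 nodes] nodes_pos sum_nodes_set_le[of "subtrees b"]
      nodes_eq[of b] by (simp add: Suc_le_eq)
  then show "card (SIGMA b:set_mset (subtrees a). set_mset (subtrees b)) \<le> nodes a"
    by (intro card_descents_le) auto
qed simp

lemma finite_descents: "finite (descents t)"
  by (simp add: descents_def)

section \<open>Redistributing the branches at the root\<close>

definition sorted_subtrees :: "rtree \<Rightarrow> rtree list" where
  "sorted_subtrees t = sort_key nodes (SOME xs. mset xs = subtrees t)"

lemma mset_sorted_subtrees: "mset (sorted_subtrees t) = subtrees t"
  unfolding sorted_subtrees_def using someI_ex[OF ex_mset[of "subtrees t"]] by simp

text \<open>On average a branch has fewer than 36 nodes. From the third smallest on there are at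
  least half of all branches, because there are at least four, so the third smallest has at most
  twice 36 nodes.\<close>

lemma nodes_three_smallest_subtrees:
  assumes "i < 3" "3 < size (subtrees t)" "nodes t \<le> 36 * size (subtrees t)"
  shows "nodes (sorted_subtrees t ! i) \<le> 72"
proof -
  let ?xs = "sorted_subtrees t"
  have len: "length ?xs = size (subtrees t)" by (metis mset_sorted_subtrees size_mset)
  have srt: "sorted (map nodes ?xs)" by (simp add: sorted_subtrees_def)
  have i2: "nodes (?xs ! i) \<le> nodes (?xs ! 2)"
    using sorted_nth_mono[OF srt, of i 2] assms len by simp
  have "(length ?xs - 2) * nodes (?xs ! 2) \<le> (\<Sum>x\<leftarrow>drop 2 ?xs. nodes x)"
  proof -
    have "nodes (?xs ! 2) \<le> nodes x" if x: "x \<in> set (drop 2 ?xs)" for x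
    proof -
      obtain j where j: "j < length ?xs - 2" "x = ?xs ! (2 + j)"
        using x by (auto simp: in_set_conv_nth)
      then show ?thesis using sorted_nth_mono[OF srt, of 2 "2 + j"] by simp
    qed
    then have "(\<Sum>x\<leftarrow>drop 2 ?xs. nodes (?xs ! 2)) \<le> (\<Sum>x\<leftarrow>drop 2 ?xs. nodes x)"
      by (intro sum_list_mono)
    then show ?thesis by (simp add: sum_list_triv)
  qed
  also have "\<dots> \<le> (\<Sum>x\<leftarrow>take 2 ?xs @ drop 2 ?xs. nodes x)" by (simp del: append_take_drop_id)
  also have "\<dots> = \<Sum>\<^sub># (image_mset nodes (mset ?xs))"
    by (simp flip: sum_mset_sum_list mset_map)
  also have "\<dots> \<le> 36 * length ?xs" using nodes_eq[of t] assms len by (simp add: mset_sorted_subtrees)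
  also have "\<dots> \<le> (length ?xs - 2) * 72" using assms len by simp
  finally have "nodes (?xs ! 2) \<le> 72" using assms len by simp
  with i2 show ?thesis by simp
qed

text \<open>
  The trees of \<open>b0\<close>, \<open>b1\<close>, \<open>b2\<close>, \<open>b3\<close> hang below the four vertices of a path starting at the root;
  \<open>f\<close> extra leaves at its end keep the total number of nodes. The path is returned along with the tree.
\<close>

definition chain_tree :: "rtree list \<Rightarrow> rtree list \<Rightarrow> rtree list \<Rightarrow> rtree list \<Rightarrow> nat \<Rightarrow> rtree \<times> rtree \<times> rtree \<times> rtree" where
  "chain_tree b0 b1 b2 b3 f =
    (let c3 = Node (mset b3 + replicate_mset f (Node {#}));
         c2 = Node (add_mset c3 (mset b2));
         c1 = Node (add_mset c2 (mset b1))
     in (Node (add_mset c1 (mset b0)), c1, c2, c3))"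

text \<open>The path tells which branch to take out at each level and \<open>f\<close> how many
  leaves to remove at the end; what is left are the four groups.\<close>

lemma chain_tree_inject:
  assumes "chain_tree b0 b1 b2 b3 f = chain_tree b0' b1' b2' b3' f"
  shows "mset b0 = mset b0' \<and> mset b1 = mset b1' \<and> mset b2 = mset b2' \<and> mset b3 = mset b3'"
  using assms by (clarsimp simp: chain_tree_def Let_def)

text \<open>The root accounts for \<open>Suc\<close>, the extra leaves and the three path vertices
  below the root for \<open>f + 3\<close>.\<close>

lemma chain_tree_in:
  assumes "Suc (\<Sum>\<^sub># (image_mset nodes (mset (b0 @ b1 @ b2 @ b3)))) + (f + 3) = n"
  shows "chain_tree b0 b1 b2 b3 f \<in> (SIGMA r:rtrees n. descents r)"
  using assms by (simp add: chain_tree_def Let_def rtrees_def descents_def)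

text \<open>The map \<open>\<Phi>\<close> sends a tree of large root degree and three block lengths
  injectively to a tree with a marked path and the three removed branches. The block lengths give
  \<open>m ^ 3\<close> choices, the path at most \<open>n\<close>, and the removed branches a number
  independent of \<open>n\<close>.\<close>

lemma card_large_root_degree:
  assumes n: "109 \<le> n"
  shows "card {t \<in> rtrees n. n \<le> 36 * size (subtrees t)} * (n div 108 - 1) ^ 3
    \<le> card (rtrees n) * n * card {t. nodes t \<le> 72} ^ 3"
proof -
  define Bad where "Bad = {t \<in> rtrees n. n \<le> 36 * size (subtrees t)}"
  define S where "S = {t. nodes t \<le> 72}"
  \<comment> \<open>A tree in \<open>Bad\<close> keeps at least
    \<open>n div 36 - 3 \<ge> 3 * m\<close> branches after the removal of three, enough for three
    blocks shorter than \<open>m\<close>.\<close>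
  define m where "m = n div 108 - 1"
  let ?T = "\<lambda>t i. sorted_subtrees t ! i"
  \<comment> \<open>The removed nodes return as three path vertices and \<open>f t\<close> leaves.
    The subtraction is not truncated because each removed branch has a node.\<close>
  define f where "f t = nodes (?T t 0) + nodes (?T t 1) + nodes (?T t 2) - 3" for t
  define xs where "xs t = drop 3 (sorted_subtrees t)" for t
  define \<Phi> where "\<Phi> = (\<lambda>(t, i, j, l).
     (chain_tree (drop (i + j + l) (xs t)) (take i (xs t)) (take j (drop i (xs t))) (take l (drop (i + j) (xs t))) (f t),
      ?T t 0, ?T t 1, ?T t 2))"
  have bad: "3 < size (subtrees t)" "nodes t \<le> 36 * size (subtrees t)" if "t \<in> Bad" for t
    using that n by (auto simp: Bad_def rtrees_def)
  have len: "length (sorted_subtrees t) = size (subtrees t)" for t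
    by (metis mset_sorted_subtrees size_mset)
  have lenx: "3 * m \<le> length (xs t)" if "t \<in> Bad" for t
    using that by (auto simp: xs_def len m_def Bad_def)
  have sub: "subtrees t = {#?T t 0, ?T t 1, ?T t 2#} + mset (xs t)" if t: "t \<in> Bad" for t
  proof -
    have "sorted_subtrees t = ?T t 0 # ?T t 1 # ?T t 2 # xs t"
      using bad[OF t] len[of t] unfolding xs_def
      by (metis (no_types, lifting) Cons_nth_drop_Suc One_nat_def Suc_1 Suc_lessD drop0 eval_nat_numeral(3) zero_less_Suc less_trans)
    then have "mset (sorted_subtrees t) = mset (?T t 0 # ?T t 1 # ?T t 2 # xs t)" by simp
    then show ?thesis by (simp add: mset_sorted_subtrees)
  qed
  have split: "mset (drop (i + j + l) ys) + mset (take i ys) + mset (take j (drop i ys)) + mset (take l (drop (i + j) ys)) = mset ys"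
    for i j l and ys :: "rtree list"
  proof -
    have "ys = take i ys @ take j (drop i ys) @ take l (drop (i + j) ys) @ drop (i + j + l) ys"
      by (metis append_take_drop_id drop_drop add.commute)
    then have "mset ys = mset (take i ys @ take j (drop i ys) @ take l (drop (i + j) ys) @ drop (i + j + l) ys)"
      by (rule arg_cong)
    then show ?thesis by (simp add: ac_simps)
  qed
  have "inj_on \<Phi> (Bad \<times> {..<m} \<times> {..<m} \<times> {..<m})"
  proof (rule inj_onI)
    fix x y
    assume xy: "x \<in> Bad \<times> {..<m} \<times> {..<m} \<times> {..<m}" "y \<in> Bad \<times> {..<m} \<times> {..<m} \<times> {..<m}"
      and "\<Phi> x = \<Phi> y"
    obtain t i j l t' i' j' l' where x: "x = (t, i, j, l)" and y: "y = (t', i', j', l')"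
      by (metis prod_cases4)
    have a: "t \<in> Bad" "i < m" "j < m" "l < m" "t' \<in> Bad" "i' < m" "j' < m" "l' < m"
      and eq: "\<Phi> (t, i, j, l) = \<Phi> (t', i', j', l')"
      using xy \<open>\<Phi> x = \<Phi> y\<close> x y by auto
    then have T: "?T t 0 = ?T t' 0" "?T t 1 = ?T t' 1" "?T t 2 = ?T t' 2"
      by (auto simp: \<Phi>_def)
    then have "f t = f t'" by (simp add: f_def)
    with eq have "chain_tree (drop (i + j + l) (xs t)) (take i (xs t)) (take j (drop i (xs t)))
        (take l (drop (i + j) (xs t))) (f t)
      = chain_tree (drop (i' + j' + l') (xs t')) (take i' (xs t')) (take j' (drop i' (xs t')))
        (take l' (drop (i' + j') (xs t'))) (f t)"
      unfolding \<Phi>_def by simp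
    from chain_tree_inject[OF this]
    have m: "mset (drop (i + j + l) (xs t)) = mset (drop (i' + j' + l') (xs t'))"
      "mset (take i (xs t)) = mset (take i' (xs t'))"
      "mset (take j (drop i (xs t))) = mset (take j' (drop i' (xs t')))"
      "mset (take l (drop (i + j) (xs t))) = mset (take l' (drop (i' + j') (xs t')))"
      by blast+
    \<comment> \<open>The four groups together give the remaining branches, and with the three
      recorded ones the tree \<open>t\<close>. The sizes of the blocks then give \<open>i\<close>,
      \<open>j\<close> and \<open>l\<close>.\<close>
    have "mset (xs t) = mset (xs t')"
      unfolding split[of i j l "xs t", symmetric] split[of i' j' l' "xs t'", symmetric] by (simp only: m)
    then have "t = t'" using sub[OF a(1)] sub[OF a(5)] T by (metis rtree.expand)
    moreover have "i = i' \<and> j = j' \<and> l = l'"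
      using m(2-4)[THEN mset_eq_length] lenx[OF a(1)] lenx[OF a(5)] a by simp
    ultimately show "x = y" by (simp add: x y)
  qed
  moreover have "\<Phi> ` (Bad \<times> {..<m} \<times> {..<m} \<times> {..<m}) \<subseteq> (SIGMA r:rtrees n. descents r) \<times> S \<times> S \<times> S"
  proof (rule image_subsetI)
    fix x assume "x \<in> Bad \<times> {..<m} \<times> {..<m} \<times> {..<m}"
    then obtain t i j l where x: "x = (t, i, j, l)" and t: "t \<in> Bad" by auto
    have S: "?T t i \<in> S" if "i < 3" for i
      using nodes_three_smallest_subtrees[OF that] bad[OF t] by (simp add: S_def)
    let ?ys = "xs t"
    have "chain_tree (drop (i + j + l) ?ys) (take i ?ys) (take j (drop i ?ys)) (take l (drop (i + j) ?ys)) (f t)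
      \<in> (SIGMA r:rtrees n. descents r)"
    proof (rule chain_tree_in)
      have "f t + 3 = nodes (?T t 0) + nodes (?T t 1) + nodes (?T t 2)"
        using nodes_pos[of "?T t 0"] nodes_pos[of "?T t 1"] nodes_pos[of "?T t 2"] by (simp add: f_def)
      moreover have "mset (drop (i + j + l) ?ys @ take i ?ys @ take j (drop i ?ys) @ take l (drop (i + j) ?ys)) = mset ?ys"
        using split[where ys = ?ys] by (simp add: add.assoc)
      moreover have "nodes t = n" using t by (simp add: Bad_def rtrees_def)
      ultimately show "Suc (\<Sum>\<^sub># (image_mset nodes (mset (drop (i + j + l) ?ys @ take i ?ys @ take j (drop i ?ys) @ take l (drop (i + j) ?ys))))) + (f t + 3) = n"
        using nodes_eq[of t] unfolding sub[OF t] by simp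
    qed
    then show "\<Phi> x \<in> (SIGMA r:rtrees n. descents r) \<times> S \<times> S \<times> S"
      unfolding x using S by (simp add: \<Phi>_def)
  qed
  moreover have fS: "finite S" unfolding S_def by (rule finite_nodes_le)
  have fC: "finite ((SIGMA r:rtrees n. descents r) \<times> S \<times> S \<times> S)"
    using fS finite_rtrees finite_descents by blast
  ultimately have "card (Bad \<times> {..<m} \<times> {..<m} \<times> {..<m}) \<le> card ((SIGMA r:rtrees n. descents r) \<times> S \<times> S \<times> S)"
    using card_inj_on_le fC by blast
  also have "\<dots> = (\<Sum>r\<in>rtrees n. card (descents r)) * card S ^ 3"
    using finite_rtrees finite_descents by (simp add: card_cartesian_product eval_nat_numeral)
  also have "(\<Sum>r\<in>rtrees n. card (descents r)) \<le> card (rtrees n) * n"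
    using sum_bounded_above[of "rtrees n" "\<lambda>r. card (descents r)" n] card_descents
    by (simp add: rtrees_def) (metis)
  finally show ?thesis
    by (simp add: card_cartesian_product Bad_def S_def m_def power3_eq_cube mult.assoc)
qed

section \<open>Shapes of rooted trees\<close>

context rooted_tree
begin

text \<open>Induction from the leaves upwards: the measure is the gap to the greatest depth.\<close>

lemma children_induct [consumes 1, case_names step]:
  assumes "v \<in> V" and step: "\<And>v. v \<in> V \<Longrightarrow> (\<And>u. u \<in> children v \<Longrightarrow> P u) \<Longrightarrow> P v"
  shows "P v"
  using assms(1)
proof (induction "Max (d ` V) - d v" arbitrary: v rule: less_induct)
  case less
  show ?case
  proof (rule step[OF less.prems])
    fix u assume "u \<in> children v"
    then have u: "u \<in> V" "d u = Suc (d v)" using childrenD by auto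
    have "d u \<le> Max (d ` V)" using finite_V u(1) by (intro Max_ge) auto
    then have "Max (d ` V) - d u < Max (d ` V) - d v" using u(2) by linarith
    then show "P u" using less.hyps u(1) by blast
  qed
qed

lemma children_neq:
  assumes "u \<in> children v" shows "u \<noteq> p v"
proof
  assume u: "u = p v"
  note c = childrenD[OF assms]
  show False
  proof (cases "v = r")
    case True
    then show False using c u p_root by simp
  next
    case False
    then have "d v = Suc (d u)" using d_p[of v] c u by simp
    then show False using c by linarith
  qed
qed

text \<open>The root is covered too: \<open>p r = r\<close>, and excluding \<open>r\<close> from its
  own neighbours excludes nothing.\<close>

lemma away_from_parent: "v \<in> V \<Longrightarrow> {w. {v, w} \<in> E \<and> w \<noteq> p v} = children v"
proof -
  assume "v \<in> V"
  have "{w. {v, w} \<in> E \<and> w \<noteq> p v} = {w. {v, w} \<in> E} - {p v}" by blast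
  also have "\<dots> = children v"
    using children_neq[of "p v" v] unfolding neighbors_eq by auto
  finally show ?thesis .
qed

end

text \<open>
  \<open>shape E u v t\<close>: the branch at \<open>v\<close> pointing away from its neighbour \<open>u\<close> has shape \<open>t\<close>. For a root
  there is no neighbour to exclude, which is expressed by \<open>u = v\<close>.
\<close>

inductive shape :: "'a set set \<Rightarrow> 'a \<Rightarrow> 'a \<Rightarrow> rtree \<Rightarrow> bool" for E where
  shapeI: "finite {w. {v, w} \<in> E \<and> w \<noteq> u} \<Longrightarrow>
    (\<And>w. {v, w} \<in> E \<Longrightarrow> w \<noteq> u \<Longrightarrow> shape E v w (f w)) \<Longrightarrow>
    shape E u v (Node (image_mset f (mset_set {w. {v, w} \<in> E \<and> w \<noteq> u})))"

lemma shape_unique: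
  assumes "shape E u v t" "shape E u v t'"
  shows "t = t'"
  using assms
proof (induction arbitrary: t' rule: shape.induct)
  case (shapeI v u f)
  from shapeI.prems obtain g where t': "t' = Node (image_mset g (mset_set {w. {v, w} \<in> E \<and> w \<noteq> u}))"
    and g: "\<And>w. {v, w} \<in> E \<Longrightarrow> w \<noteq> u \<Longrightarrow> shape E v w (g w)"
    by (cases rule: shape.cases) blast
  have "f w = g w" if "w \<in> {w. {v, w} \<in> E \<and> w \<noteq> u}" for w
    using that shapeI.IH g by blast
  then show ?case unfolding t' using shapeI.hyps(1)
    by (intro arg_cong[of _ _ Node] image_mset_cong) simp
qed

lemma shape_isomorphic:
  assumes "shape E u v t" and bij: "bij_betw \<phi> V V'"
    and edge: "\<And>x y. x \<in> V \<Longrightarrow> y \<in> V \<Longrightarrow> {x, y} \<in> E \<longleftrightarrow> {\<phi> x, \<phi> y} \<in> E'"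
    and E: "\<And>x y. {x, y} \<in> E \<Longrightarrow> x \<in> V" and E': "\<And>x y. {x, y} \<in> E' \<Longrightarrow> x \<in> V'"
    and uv: "u \<in> V" "v \<in> V"
  shows "shape E' (\<phi> u) (\<phi> v) t"
  using assms(1) uv
proof (induction rule: shape.induct)
  case (shapeI v u f)
  let ?S = "{w. {v, w} \<in> E \<and> w \<noteq> u}" and ?S' = "{w. {\<phi> v, w} \<in> E' \<and> w \<noteq> \<phi> u}"
  have inj: "inj_on \<phi> V" and im: "\<phi> ` V = V'" using bij by (auto simp: bij_betw_def)
  have "w \<in> V" if "{v, w} \<in> E" for w using E[of w v] that by (simp add: insert_commute)
  then have SV: "?S \<subseteq> V" by blast
  then have injS: "inj_on \<phi> ?S" using inj inj_on_subset by blast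
  have S': "?S' = \<phi> ` ?S"
  proof (intro equalityI subsetI)
    fix w' assume w': "w' \<in> ?S'"
    then have "w' \<in> V'" using E'[of w' "\<phi> v"] by (simp add: insert_commute)
    then obtain w where "w \<in> V" "w' = \<phi> w" using im by auto
    then show "w' \<in> \<phi> ` ?S" using w' edge[of v w] shapeI.prems by auto
  next
    fix w' assume "w' \<in> \<phi> ` ?S"
    then obtain w where w: "{v, w} \<in> E" "w \<noteq> u" "w' = \<phi> w" by auto
    moreover have "w \<in> V" using SV w by auto
    ultimately show "w' \<in> ?S'"
      using edge[of v w] shapeI.prems inj_on_eq_iff[OF inj, of w u] by auto
  qed
  let ?g = "\<lambda>w'. f (inv_into ?S \<phi> w')"
  have "shape E' (\<phi> u) (\<phi> v) (Node (image_mset ?g (mset_set ?S')))"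
  proof (rule shape.shapeI)
    show "finite ?S'" unfolding S' using shapeI.hyps(1) by simp
    fix w' assume "{\<phi> v, w'} \<in> E'" "w' \<noteq> \<phi> u"
    then have "w' \<in> ?S'" by simp
    then obtain w where w: "w \<in> ?S" "w' = \<phi> w" unfolding S' by blast
    then have "inv_into ?S \<phi> w' = w" using injS by simp
    moreover have "shape E' (\<phi> v) (\<phi> w) (f w)" using shapeI.IH w(1) SV shapeI.prems by blast
    ultimately show "shape E' (\<phi> v) w' (?g w')" using w(2) by simp
  qed
  moreover have "image_mset ?g (mset_set ?S') = image_mset f (mset_set ?S)"
  proof -
    have "mset_set ?S' = image_mset \<phi> (mset_set ?S)"
      unfolding S' using image_mset_mset_set[OF injS] by simp
    then have "image_mset ?g (mset_set ?S') = image_mset (\<lambda>w. ?g (\<phi> w)) (mset_set ?S)"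
      by (simp add: multiset.map_comp comp_def)
    also have "\<dots> = image_mset f (mset_set ?S)"
      using shapeI.hyps(1) injS by (intro image_mset_cong) auto
    finally show ?thesis .
  qed
  ultimately show ?case by simp
qed

text \<open>Only the edges and the root enter, not a parent function. This makes the shape an
  invariant of the rooted graph.\<close>

definition rooted_shape :: "'a sgraph \<Rightarrow> 'a \<Rightarrow> rtree" where
  "rooted_shape G r = (THE t. shape (snd G) r r t)"

context rooted_tree
begin

definition shape_of :: "'a \<Rightarrow> rtree" where
  "shape_of v = (THE t. shape E (p v) v t)"

lemma shape_of_eqI: "shape E (p v) v t \<Longrightarrow> shape_of v = t"
  unfolding shape_of_def by (blast intro: the_equality shape_unique)

lemma shapeI_children:
  assumes "v \<in> V" "\<And>u. u \<in> children v \<Longrightarrow> shape E (p u) u (f u)"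
  shows "shape E (p v) v (Node (image_mset f (mset_set (children v))))"
proof -
  have "shape E (p v) v (Node (image_mset f (mset_set {w. {v, w} \<in> E \<and> w \<noteq> p v})))"
  proof (rule shape.shapeI)
    show "finite {w. {v, w} \<in> E \<and> w \<noteq> p v}"
      using away_from_parent[OF assms(1)] finite_children by simp
    fix w assume "{v, w} \<in> E" "w \<noteq> p v"
    then have w: "w \<in> children v" using away_from_parent[OF assms(1)] by blast
    then have "p w = v" using childrenD by simp
    then show "shape E v w (f w)" using assms(2)[OF w] by simp
  qed
  then show ?thesis using away_from_parent[OF assms(1)] by simp
qed

lemma shape_shape_of: "v \<in> V \<Longrightarrow> shape E (p v) v (shape_of v)"
proof (induction rule: children_induct)
  case (step v)
  then show ?case using shapeI_children[of v shape_of] shape_of_eqI by metis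
qed

lemma shape_of_eq:
  "v \<in> V \<Longrightarrow> shape_of v = Node (image_mset shape_of (mset_set (children v)))"
proof -
  assume v: "v \<in> V"
  have "shape E (p u) u (shape_of u)" if "u \<in> children v" for u
    using shape_shape_of[of u] childrenD[OF that] by blast
  then show ?thesis by (rule shape_of_eqI[OF shapeI_children[OF v]])
qed

text \<open>Serves to read off the shape when a solution of the recursion is known, as for position
  trees.\<close>

lemma shape_of_unique:
  assumes "\<And>v. v \<in> V \<Longrightarrow> \<tau> v = Node (image_mset \<tau> (mset_set (children v)))" and "v \<in> V"
  shows "shape_of v = \<tau> v"
  using assms(2)
proof (induction rule: children_induct)
  case (step v)
  then show ?case
    unfolding shape_of_eq[OF step.hyps] assms(1)[OF step.hyps]
    using finite_children by (intro arg_cong[of _ _ Node] image_mset_cong) simp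
qed

lemma rooted_shape_eq: "rooted_shape (V, E) r = shape_of r"
  unfolding rooted_shape_def shape_of_def p_root snd_conv ..

text \<open>When the recursion for the sizes is summed over \<open>V\<close>, every vertex except
  the root occurs once as a child. After cancellation only the value at the root and
  \<open>card V\<close> remain.\<close>

lemma nodes_shape_of_root: "nodes (shape_of r) = card V"
proof -
  let ?N = "\<lambda>v. nodes (shape_of v)"
  have "?N v = Suc (\<Sum>u\<in>children v. ?N u)" if "v \<in> V" for v
    by (subst shape_of_eq[OF that]) (simp add: multiset.map_comp comp_def sum_unfold_sum_mset)
  then have "(\<Sum>v\<in>V. ?N v) = card V + (\<Sum>v\<in>V. \<Sum>u\<in>children v. ?N u)"
    by (simp add: sum_Suc)
  also have "(\<Sum>v\<in>V. \<Sum>u\<in>children v. ?N u) = (\<Sum>u\<in>V - {r}. ?N u)"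
    unfolding children_def using finite_V p_in by (intro sum.group) auto
  finally show ?thesis
    using sum.remove[OF finite_V root, of ?N] by linarith
qed

lemma degree_root: "size (subtrees (shape_of r)) = vertex_degree (V, E) r"
proof -
  have "{w. {r, w} \<in> E} = children r" by (simp add: neighbors_eq)
  then show ?thesis by (subst shape_of_eq[OF root]) (simp add: vertex_degree_def)
qed

end

section \<open>Equal rooted shapes give isomorphic trees\<close>

lemma ex_bij_betw_if_image_mset_eq:
  assumes "finite A" "finite B" "image_mset f (mset_set A) = image_mset g (mset_set B)"
  shows "\<exists>h. bij_betw h A B \<and> (\<forall>a\<in>A. g (h a) = f a)"
  using assms
proof (induction A arbitrary: B rule: finite_induct)
  case empty
  have "card B = 0" using arg_cong[OF empty.prems(2), of size] by simp
  then have "B = {}" using empty.prems(1) by simp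
  then show ?case by (auto simp: bij_betw_def)
next
  case (insert a A)
  then have eq: "add_mset (f a) (image_mset f (mset_set A)) = image_mset g (mset_set B)" by simp
  then have "f a \<in># image_mset g (mset_set B)" by (metis union_single_eq_member)
  then obtain b where b: "b \<in> B" "g b = f a" using insert.prems(1) by auto
  have "mset_set B = add_mset b (mset_set (B - {b}))"
    using b insert.prems(1) by (simp add: mset_set.remove)
  then have "image_mset f (mset_set A) = image_mset g (mset_set (B - {b}))"
    using eq b by simp
  then obtain h where h: "bij_betw h A (B - {b})" "\<forall>a\<in>A. g (h a) = f a"
    using insert.IH[of "B - {b}"] insert.prems(1) by auto
  define h' where "h' = h(a := b)"
  have "bij_betw h' A (B - {b})" "\<forall>a\<in>A. g (h' a) = f a"
    using h insert.hyps by (auto simp: h'_def bij_betw_def inj_on_def image_iff)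
  moreover have "h' a = b" by (simp add: h'_def)
  ultimately have "bij_betw h' (insert a A) (B - {b} \<union> {b})"
    using insert.hyps notIn_Un_bij_betw[of a A h' "B - {b}"] by simp
  then have "bij_betw h' (insert a A) B" using b by (simp add: insert_absorb)
  then show ?case using b \<open>\<forall>a\<in>A. g (h' a) = f a\<close> \<open>h' a = b\<close> by (intro exI[of _ h']) auto
qed

text \<open>The isomorphism is built from the root down: for two vertices of equal shape,
  \<open>H\<close> picks a shape-preserving bijection between their children, and
  \<open>\<phi>\<close> follows these choices along the path from the root.\<close>

lemma isomorphic_if_same_shape:
  assumes "rooted_tree V r p d E" "rooted_tree V' r' p' d' E'"
    and eq: "rooted_shape (V, E) r = rooted_shape (V', E') r'"
  shows "graph_isomorphic (V, E) (V', E')"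
proof -
  interpret A: rooted_tree V r p d E by fact
  interpret B: rooted_tree V' r' p' d' E' by fact
  define good where "good x x' h \<longleftrightarrow> bij_betw h (A.children x) (B.children x') \<and>
    (\<forall>u\<in>A.children x. B.shape_of (h u) = A.shape_of u)" for x x' h
  define H where "H x x' = (SOME h. good x x' h)" for x x'
  have H: "good x x' (H x x')" if "x \<in> V" "x' \<in> V'" "B.shape_of x' = A.shape_of x" for x x'
  proof -
    have "image_mset A.shape_of (mset_set (A.children x)) = image_mset B.shape_of (mset_set (B.children x'))"
      using A.shape_of_eq[OF that(1)] B.shape_of_eq[OF that(2)] that(3) by simp
    then have "\<exists>h. good x x' h"
      unfolding good_def by (intro ex_bij_betw_if_image_mset_eq A.finite_children B.finite_children)
    then show ?thesis unfolding H_def by (rule someI_ex)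
  qed
  \<comment> \<open>Recursion on the depth, with values that are functions of the vertex. The test
    \<open>v = r\<close> also stands in the successor case because \<open>d r\<close> may be
    positive.\<close>
  define F where "F = rec_nat (\<lambda>v. r') (\<lambda>_ F v. if v = r then r' else H (p v) (F (p v)) v)"
  define \<phi> where "\<phi> v = F (d v) v" for v
  have \<phi>_r: "\<phi> r = r'" unfolding \<phi>_def F_def by (cases "d r") simp_all
  have \<phi>_step: "\<phi> v = H (p v) (\<phi> (p v)) v" if "v \<in> V" "v \<noteq> r" for v
    using A.d_p[OF that] that by (simp add: \<phi>_def F_def)
  have inv: "\<phi> v \<in> V' \<and> B.shape_of (\<phi> v) = A.shape_of v" if "v \<in> V" for v
    using that
  proof (induction "d v" arbitrary: v rule: less_induct)
    case less
    show ?case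
    proof (cases "v = r")
      case True
      then show ?thesis using eq \<phi>_r B.root by (simp add: A.rooted_shape_eq B.rooted_shape_eq)
    next
      case False
      then have "good (p v) (\<phi> (p v)) (H (p v) (\<phi> (p v)))"
        using less A.d_p A.p_in H by simp
      then show ?thesis
        using A.child_of_parent[OF less.prems False] \<phi>_step[OF less.prems False] B.childrenD
        unfolding good_def by (metis bij_betwE)
    qed
  qed
  then have good: "good x (\<phi> x) (H x (\<phi> x))" if "x \<in> V" for x using that H by blast
  have child: "\<phi> v \<in> B.children (\<phi> (p v))" if "v \<in> V" "v \<noteq> r" for v
    using good[OF A.p_in[OF that]] A.child_of_parent[OF that] \<phi>_step[OF that]
    unfolding good_def by (metis bij_betwE)
  have inj: "u = v" if "u \<in> V" "v \<in> V" "\<phi> u = \<phi> v" for u v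
    using that
  proof (induction "d u" arbitrary: u v rule: less_induct)
    case less
    show ?case
    proof (cases "u = r \<or> v = r")
      case True
      then show ?thesis using less.prems child \<phi>_r B.childrenD by metis
    next
      case False
      then have pe: "\<phi> (p u) = \<phi> (p v)" using child less.prems B.childrenD by metis
      then have "p u = p v" using less.hyps[of "p u" "p v"] less.prems False A.p_in A.d_p[of u] by simp
      then have "H (p u) (\<phi> (p u)) u = H (p u) (\<phi> (p u)) v" "u \<in> A.children (p u)" "v \<in> A.children (p u)"
        using \<phi>_step False less.prems A.child_of_parent by metis+
      then show ?thesis
        using good[of "p u"] A.p_in False less.prems unfolding good_def bij_betw_def by (metis inj_onD)
    qed
  qed
  have surj: "v' \<in> \<phi> ` V" if "v' \<in> V'" for v'
    using that
  proof (induction "d' v'" arbitrary: v' rule: less_induct)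
    case less
    show ?case
    proof (cases "v' = r'")
      case True
      then show ?thesis using \<phi>_r A.root by blast
    next
      case False
      then obtain u where u: "u \<in> V" "p' v' = \<phi> u"
        using less B.p_in B.d_p by (metis imageE lessI)
      then have "v' \<in> B.children (\<phi> u)" using B.child_of_parent[OF less.prems False] by simp
      then obtain w where w: "w \<in> A.children u" "v' = H u (\<phi> u) w"
        using good[OF u(1)] unfolding good_def bij_betw_def by blast
      then have "v' = \<phi> w" using \<phi>_step[of w] A.childrenD by metis
      then show ?thesis using w A.childrenD by blast
    qed
  qed
  have "bij_betw \<phi> V V'"
    unfolding bij_betw_def inj_on_def using inj inv surj by blast
  moreover have cc: "u \<in> A.children v \<longleftrightarrow> \<phi> u \<in> B.children (\<phi> v)" if "u \<in> V" "v \<in> V" for u v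
  proof
    assume "u \<in> A.children v"
    then show "\<phi> u \<in> B.children (\<phi> v)" using child[of u] A.childrenD by metis
  next
    assume c: "\<phi> u \<in> B.children (\<phi> v)"
    then have "u \<noteq> r" using \<phi>_r B.childrenD by metis
    then have "\<phi> (p u) = \<phi> v" using child[of u] that c B.childrenD by metis
    then have "p u = v" using inj A.p_in that \<open>u \<noteq> r\<close> by blast
    then show "u \<in> A.children v" using A.child_of_parent that \<open>u \<noteq> r\<close> by blast
  qed
  ultimately show ?thesis
    unfolding graph_isomorphic_def by (intro exI[of _ \<phi>]) (simp add: A.edge_iff B.edge_iff)
qed

section \<open>Realizing every shape by a labeled tree\<close>

definition position_tree :: "nat list set \<Rightarrow> (nat list \<Rightarrow> rtree) \<Rightarrow> rtree \<Rightarrow> bool" where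
  "position_tree V \<tau> t \<longleftrightarrow> finite V \<and> [] \<in> V \<and> (\<forall>v\<in>V. v \<noteq> [] \<longrightarrow> butlast v \<in> V) \<and> \<tau> [] = t \<and>
    (\<forall>v\<in>V. \<tau> v = Node (image_mset \<tau> (mset_set {u \<in> V - {[]}. butlast u = v})))"

text \<open>A vertex is its address, the list of branch indices on the way from the root, so its
  parent is given by \<open>butlast\<close>. The addresses in branch \<open>i\<close> are prefixed
  by \<open>i\<close>, and \<open>\<tau>\<close> gives the branch hanging at an address.\<close>

lemma ex_position_tree: "\<exists>V \<tau>. position_tree V \<tau> t"
proof (induction t)
  case (Node M)
  obtain ts where ts: "M = mset ts" by (metis ex_mset)
  have "\<exists>V \<tau>. position_tree V \<tau> (ts ! i)" if "i < length ts" for i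
    using Node.IH[of "ts ! i"] that by (simp add: ts)
  then obtain W \<sigma> where "\<And>i. i < length ts \<Longrightarrow> position_tree (W i) (\<sigma> i) (ts ! i)"
    by metis
  then have W: "\<And>i. i < length ts \<Longrightarrow> finite (W i)" "\<And>i. i < length ts \<Longrightarrow> [] \<in> W i"
    "\<And>i v. i < length ts \<Longrightarrow> v \<in> W i \<Longrightarrow> v \<noteq> [] \<Longrightarrow> butlast v \<in> W i"
    "\<And>i. i < length ts \<Longrightarrow> \<sigma> i [] = ts ! i"
    "\<And>i v. i < length ts \<Longrightarrow> v \<in> W i \<Longrightarrow> \<sigma> i v = Node (image_mset (\<sigma> i) (mset_set {u \<in> W i - {[]}. butlast u = v}))"
    unfolding position_tree_def by blast+
  define V where "V = insert [] (\<Union>i<length ts. (#) i ` W i)"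
  define \<tau> where "\<tau> v = (case v of [] \<Rightarrow> Node M | i # u \<Rightarrow> \<sigma> i u)" for v
  have "finite V" using W(1) by (auto simp: V_def)
  moreover have "[] \<in> V" by (simp add: V_def)
  moreover have "butlast v \<in> V" if "v \<in> V" "v \<noteq> []" for v
  proof -
    obtain i w where v: "v = i # w" "i < length ts" "w \<in> W i" using \<open>v \<in> V\<close> \<open>v \<noteq> []\<close> by (auto simp: V_def)
    show ?thesis
    proof (cases "w = []")
      case False
      then have "i # butlast w \<in> (#) i ` W i" using W(3) v by blast
      then show ?thesis using v False by (auto simp: V_def)
    qed (simp add: v V_def)
  qed
  moreover have "\<tau> [] = Node M" by (simp add: \<tau>_def)
  moreover have "\<tau> v = Node (image_mset \<tau> (mset_set {u \<in> V - {[]}. butlast u = v}))" if v: "v \<in> V" for v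
  proof (cases v)
    case Nil
    have "{u \<in> V - {[]}. butlast u = v} = (\<lambda>i. [i]) ` {..<length ts}"
      using W(2) Nil by (auto simp: V_def split: if_splits)
    then have "image_mset \<tau> (mset_set {u \<in> V - {[]}. butlast u = v})
        = image_mset (\<lambda>i. \<tau> [i]) (mset_set {..<length ts})"
      by (simp add: image_mset_mset_set[symmetric] inj_on_def multiset.map_comp comp_def)
    also have "\<dots> = image_mset (\<lambda>i. ts ! i) (mset_set {..<length ts})"
      by (intro image_mset_cong) (simp add: \<tau>_def W(4))
    also have "\<dots> = mset (map (\<lambda>i. ts ! i) [0..<length ts])"
      by (simp add: atLeast0LessThan)
    also have "\<dots> = M" by (simp add: map_nth ts)
    finally show ?thesis by (simp add: \<tau>_def Nil)
  next
    case (Cons i w)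
    then have i: "i < length ts" "w \<in> W i" using v by (auto simp: V_def)
    have "{u \<in> V - {[]}. butlast u = v} = (#) i ` {u \<in> W i - {[]}. butlast u = w}"
      using i Cons by (auto simp: V_def split: if_splits)
    then have "image_mset \<tau> (mset_set {u \<in> V - {[]}. butlast u = v})
        = image_mset (\<lambda>u. \<tau> (i # u)) (mset_set {u \<in> W i - {[]}. butlast u = w})"
      by (simp add: image_mset_mset_set[symmetric] inj_on_def multiset.map_comp comp_def)
    also have "\<dots> = image_mset (\<sigma> i) (mset_set {u \<in> W i - {[]}. butlast u = w})"
      by (simp add: \<tau>_def)
    finally show ?thesis using W(5)[OF i] by (simp add: \<tau>_def Cons)
  qed
  ultimately have "position_tree V \<tau> (Node M)" unfolding position_tree_def by blast
  then show ?case by blast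
qed

lemma rooted_tree_of_treeE:
  assumes "is_tree G" "r \<in> fst G"
  obtains V E p d where "G = (V, E)" "rooted_tree V r p d E"
  using rooted_tree_of_is_tree[OF assms] by (metis prod.collapse)

lemma
  assumes "is_tree G" "r \<in> fst G"
  shows nodes_rooted_shape: "nodes (rooted_shape G r) = card (fst G)"
    and degree_rooted_shape: "size (subtrees (rooted_shape G r)) = vertex_degree G r"
proof -
  obtain V E p d where G: "G = (V, E)" and "rooted_tree V r p d E"
    using rooted_tree_of_treeE[OF assms] by blast
  interpret rooted_tree V r p d E by fact
  show "nodes (rooted_shape G r) = card (fst G)" "size (subtrees (rooted_shape G r)) = vertex_degree G r"
    by (simp_all add: G rooted_shape_eq nodes_shape_of_root degree_root)
qed

lemma isomorphic_if_same_rooted_shape: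
  assumes G: "is_tree G" "r \<in> fst G" and H: "is_tree H" "s \<in> fst H"
    and eq: "rooted_shape G r = rooted_shape H s"
  shows "graph_isomorphic G H"
proof -
  obtain V E p d where VE: "G = (V, E)" "rooted_tree V r p d E"
    using rooted_tree_of_treeE[OF G] by blast
  obtain V' E' p' d' where VE': "H = (V', E')" "rooted_tree V' s p' d' E'"
    using rooted_tree_of_treeE[OF H] by blast
  show ?thesis
    using isomorphic_if_same_shape[OF VE(2) VE'(2)] eq unfolding VE(1) VE'(1) by blast
qed

lemma ex_same_rooted_shape_if_isomorphic:
  assumes iso: "graph_isomorphic G H" and G: "is_tree G" and H: "simple_graph H" and r: "r \<in> fst G"
  shows "\<exists>s\<in>fst H. rooted_shape H s = rooted_shape G r"
proof -
  obtain f where f: "bij_betw f (fst G) (fst H)"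
    and ef: "\<And>u v. u \<in> fst G \<Longrightarrow> v \<in> fst G \<Longrightarrow> {u, v} \<in> snd G \<longleftrightarrow> {f u, f v} \<in> snd H"
    using iso by (auto simp: graph_isomorphic_def)
  obtain V E p d where VE: "G = (V, E)" "rooted_tree V r p d E"
    using rooted_tree_of_treeE[OF G r] by blast
  interpret rooted_tree V r p d E by fact
  have sh: "shape E r r (shape_of r)" using shape_shape_of[OF root] by (simp add: p_root)
  have "shape (snd H) (f r) (f r) (shape_of r)"
  proof (rule shape_isomorphic[OF sh, of f V "fst H"])
    show "bij_betw f V (fst H)" using f by (simp add: VE(1))
    show "{x, y} \<in> E \<longleftrightarrow> {f x, f y} \<in> snd H" if "x \<in> V" "y \<in> V" for x y
      using ef[of x y] that by (simp add: VE(1))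
    show "x \<in> V" if "{x, y} \<in> E" for x y using edgeD[OF that] by simp
    show "x \<in> fst H" if "{x, y} \<in> snd H" for x y using simple_graph_edgeD(1)[OF H that] .
  qed (rule root)+
  then have "rooted_shape H (f r) = shape_of r"
    unfolding rooted_shape_def by (blast intro: the_equality shape_unique)
  moreover have "rooted_shape G r = shape_of r" unfolding VE(1) by (rule rooted_shape_eq)
  moreover have "f r \<in> fst H" using bij_betwE[OF f] r by blast
  ultimately show ?thesis by auto
qed

lemma labeled_treesD: "G \<in> labeled_trees n \<Longrightarrow> is_tree G \<and> simple_graph G \<and> fst G = {1..n}"
  by (simp add: labeled_trees_def is_tree_def)

lemma ex_labeled_tree_with_shape: "\<exists>G\<in>labeled_trees (nodes t). \<exists>r\<in>fst G. rooted_shape G r = t"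
proof -
  obtain V \<tau> where V: "position_tree V \<tau> t" using ex_position_tree by blast
  define E where "E = (\<lambda>v. {v, butlast v}) ` (V - {[]})"
  interpret rooted_tree V "[]" butlast length E
    using V by unfold_locales (auto simp: position_tree_def E_def)
  have "\<tau> v = Node (image_mset \<tau> (mset_set (children v)))" if "v \<in> V" for v
    using V that unfolding position_tree_def children_def by blast
  then have "shape_of [] = \<tau> []" by (rule shape_of_unique[OF _ root])
  then have sh: "rooted_shape (V, E) [] = t" using V rooted_shape_eq by (simp add: position_tree_def)
  then have "card (fst (V, E)) = nodes t"
    using nodes_rooted_shape[OF is_tree] root by fastforce
  then obtain H where H: "H \<in> labeled_trees (nodes t)" "graph_isomorphic (V, E) H"
    using ex_isomorphic_labeled_tree[OF is_tree] by blast
  then show ?thesis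
    using ex_same_rooted_shape_if_isomorphic[OF H(2) is_tree] labeled_treesD[OF H(1)] root sh
    by (metis fst_conv)
qed

section \<open>Isomorphism classes and rooted trees\<close>

definition iso_rel :: "nat \<Rightarrow> (nat sgraph \<times> nat sgraph) set" where
  "iso_rel n = {(G, H). G \<in> labeled_trees n \<and> H \<in> labeled_trees n \<and> graph_isomorphic G H}"

lemma unlabeled_trees_eq: "unlabeled_trees n = labeled_trees n // iso_rel n"
  by (simp add: unlabeled_trees_def iso_rel_def)

lemma equiv_iso_rel: "equiv (labeled_trees n) (iso_rel n)"
  unfolding iso_rel_def by (rule equiv_graph_isomorphic)

lemma class_nonempty: "C \<in> unlabeled_trees n \<Longrightarrow> \<exists>G. G \<in> C"
  using in_quotient_imp_non_empty[OF equiv_iso_rel] unfolding unlabeled_trees_eq by blast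

lemma class_subset: "C \<in> unlabeled_trees n \<Longrightarrow> G \<in> C \<Longrightarrow> G \<in> labeled_trees n"
  using in_quotient_imp_subset[OF equiv_iso_rel] unfolding unlabeled_trees_eq by blast

lemma class_isomorphic: "C \<in> unlabeled_trees n \<Longrightarrow> G \<in> C \<Longrightarrow> H \<in> C \<Longrightarrow> graph_isomorphic G H"
  using in_quotient_imp_in_rel[OF equiv_iso_rel, of C n G H] unfolding unlabeled_trees_eq
  by (simp add: iso_rel_def)

text \<open>A representative of each class can be rooted in \<open>n\<close> ways, and every rooted
  tree arises like this.\<close>

lemma card_rtrees_le: "card (rtrees n) \<le> n * card (unlabeled_trees n)"
proof -
  define rep where "rep C = (SOME G. G \<in> C)" for C :: "nat sgraph set"
  have rep: "rep C \<in> C" if "C \<in> unlabeled_trees n" for C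
    unfolding rep_def using class_nonempty[OF that] by (rule someI_ex)
  have "rtrees n \<subseteq> (\<lambda>(C, v). rooted_shape (rep C) v) ` (unlabeled_trees n \<times> {1..n})"
  proof
    fix t assume "t \<in> rtrees n"
    then obtain G r where G: "G \<in> labeled_trees n" "r \<in> fst G" "rooted_shape G r = t"
      using ex_labeled_tree_with_shape[of t] by (auto simp: rtrees_def)
    define C where "C = iso_rel n `` {G}"
    have C: "C \<in> unlabeled_trees n" unfolding unlabeled_trees_eq C_def using G(1) by (rule quotientI)
    have "G \<in> C" unfolding C_def using equiv_iso_rel G(1) by (rule equiv_class_self)
    then have "graph_isomorphic G (rep C)" using class_isomorphic[OF C] rep[OF C] by blast
    then obtain s where "s \<in> fst (rep C)" "rooted_shape (rep C) s = t"
      using ex_same_rooted_shape_if_isomorphic[of G "rep C" r] G labeled_treesD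
        labeled_treesD[OF class_subset[OF C rep[OF C]]] by blast
    moreover have "fst (rep C) = {1..n}" using labeled_treesD[OF class_subset[OF C rep[OF C]]] by simp
    ultimately show "t \<in> (\<lambda>(C, v). rooted_shape (rep C) v) ` (unlabeled_trees n \<times> {1..n})"
      using C by force
  qed
  then have "card (rtrees n) \<le> card (unlabeled_trees n \<times> {1..n})"
    by (rule surj_card_le[rotated]) (simp add: finite_unlabeled_trees)
  then show ?thesis by (simp add: card_cartesian_product mult.commute)
qed

definition has_hub :: "nat sgraph \<Rightarrow> bool" where
  "has_hub G \<longleftrightarrow> (\<exists>v\<in>fst G. card (fst G) \<le> 36 * vertex_degree G v)"

text \<open>Send a class to its shape seen from a hub. This is injective because the rooted shape
  determines the isomorphism class.\<close>

lemma card_classes_with_hub: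
  "card {C \<in> unlabeled_trees n. \<exists>G\<in>C. has_hub G} \<le> card {t \<in> rtrees n. n \<le> 36 * size (subtrees t)}"
proof -
  define Q where "Q C t \<longleftrightarrow> t \<in> rtrees n \<and> n \<le> 36 * size (subtrees t) \<and>
    (\<exists>G\<in>C. \<exists>v\<in>fst G. rooted_shape G v = t)" for C :: "nat sgraph set" and t
  have "\<exists>t. Q C t" if C: "C \<in> unlabeled_trees n" "\<exists>G\<in>C. has_hub G" for C
  proof -
    obtain G v where G: "G \<in> C" "v \<in> fst G" "card (fst G) \<le> 36 * vertex_degree G v"
      using C(2) by (auto simp: has_hub_def)
    have T: "is_tree G" "fst G = {1..n}" using labeled_treesD[OF class_subset[OF C(1) G(1)]] by auto
    have "rooted_shape G v \<in> rtrees n"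
      using nodes_rooted_shape[OF T(1) G(2)] T(2) by (simp add: rtrees_def)
    moreover have "n \<le> 36 * size (subtrees (rooted_shape G v))"
      using degree_rooted_shape[OF T(1) G(2)] T(2) G(3) by simp
    ultimately show ?thesis using G(1,2) unfolding Q_def by blast
  qed
  then obtain \<tau> where \<tau>: "\<And>C. C \<in> unlabeled_trees n \<Longrightarrow> \<exists>G\<in>C. has_hub G \<Longrightarrow> Q C (\<tau> C)"
    by metis
  show ?thesis
  proof (rule card_inj_on_le[of \<tau>])
    show "inj_on \<tau> {C \<in> unlabeled_trees n. \<exists>G\<in>C. has_hub G}"
    proof (rule inj_onI)
      fix C D assume C: "C \<in> {C \<in> unlabeled_trees n. \<exists>G\<in>C. has_hub G}"
        and D: "D \<in> {C \<in> unlabeled_trees n. \<exists>G\<in>C. has_hub G}" and eq: "\<tau> C = \<tau> D"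
      obtain G v where G: "G \<in> C" "v \<in> fst G" "rooted_shape G v = \<tau> C"
        using \<tau>[of C] C by (auto simp: Q_def)
      obtain H w where H: "H \<in> D" "w \<in> fst H" "rooted_shape H w = \<tau> C"
        using \<tau>[of D] D eq by (auto simp: Q_def)
      have L: "G \<in> labeled_trees n" "H \<in> labeled_trees n"
        using class_subset[of C n G] class_subset[of D n H] C D G(1) H(1) by blast+
      then have "graph_isomorphic G H"
        using isomorphic_if_same_rooted_shape[of G v H w] labeled_treesD G H by metis
      then have "(G, H) \<in> iso_rel n" using L by (simp add: iso_rel_def)
      then show "C = D"
        using quotient_eqI[OF equiv_iso_rel, of C n D G H] C D G(1) H(1) unfolding unlabeled_trees_eq by blast
    qed
  next
    show "\<tau> ` {C \<in> unlabeled_trees n. \<exists>G\<in>C. has_hub G} \<subseteq> {t \<in> rtrees n. n \<le> 36 * size (subtrees t)}"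
      using \<tau> by (auto simp: Q_def)
  qed (simp add: finite_rtrees)
qed

section \<open>Labeled trees with a vertex of large degree\<close>

text \<open>\<open>u\<close> and \<open>w\<close> are distinct children of the root, so
  \<open>w\<close> is not a descendant of \<open>u\<close> and may become its parent.\<close>

lemma (in rooted_tree) reattach_child:
  assumes u: "u \<in> children r" and w: "w \<in> children r" and "u \<noteq> w"
  shows "is_tree (V, insert {w, u} (E - {{r, u}}))" "{w, u} \<notin> E"
proof -
  define p' where "p' = p(u := w)"
  \<comment> \<open>All descendants of \<open>u\<close>, including \<open>u\<close>, move down by one.\<close>
  define d' where "d' x = d x + of_bool (\<exists>i. (p ^^ i) x = u)" for x
  have uw: "u \<in> V" "u \<noteq> r" "p u = r" "d u = Suc (d r)" "w \<in> V" "w \<noteq> r" "p w = r" "d w = Suc (d r)"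
    using childrenD[OF u] childrenD[OF w] by auto
  \<comment> \<open>Away from \<open>u\<close>, a vertex is a descendant of \<open>u\<close> exactly
    when its parent is. Hence both depths are shifted alike.\<close>
  have anc: "(\<exists>i. (p ^^ i) x = u) \<longleftrightarrow> (\<exists>i. (p ^^ i) (p x) = u)" if "x \<noteq> u" for x
  proof
    assume "\<exists>i. (p ^^ i) x = u"
    then obtain i where "(p ^^ i) x = u" by blast
    then show "\<exists>i. (p ^^ i) (p x) = u" using that by (cases i) (auto simp: funpow_swap1)
  next
    assume "\<exists>i. (p ^^ i) (p x) = u"
    then obtain i where "(p ^^ i) (p x) = u" by blast
    then have "(p ^^ Suc i) x = u" by (simp add: funpow_swap1)
    then show "\<exists>i. (p ^^ i) x = u" by blast
  qed
  have "(p ^^ i) r = r" for i by (induction i) (auto simp: p_root)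
  then have nr: "\<not> (\<exists>i. (p ^^ i) r = u)" using uw by auto
  then have nw: "\<not> (\<exists>i. (p ^^ i) w = u)" using anc[of w] uw \<open>u \<noteq> w\<close> by auto
  have au: "\<exists>i. (p ^^ i) u = u" by (rule exI[of _ 0]) simp
  have "d' x = Suc (d' (p' x))" if x: "x \<in> V" "x \<noteq> r" for x
  proof (cases "x = u")
    case True
    then show ?thesis using nw au uw by (simp add: d'_def p'_def)
  next
    case False
    then show ?thesis using anc[OF False] d_p[OF x] by (simp add: d'_def p'_def)
  qed
  moreover have "insert {w, u} (E - {{r, u}}) = (\<lambda>v. {v, p' v}) ` (V - {r})"
  proof -
    have "V - {r} = insert u (V - {r, u})" using uw by auto
    then have "(\<lambda>v. {v, p' v}) ` (V - {r}) = insert {u, w} ((\<lambda>v. {v, p v}) ` (V - {r, u}))"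
      by (auto simp: p'_def image_iff)
    moreover have "(\<lambda>v. {v, p v}) ` (V - {r, u}) = E - {{r, u}}"
      unfolding E using uw by (auto simp: doubleton_eq_iff image_iff)
    ultimately show ?thesis by (simp add: insert_commute)
  qed
  moreover have "p' x \<in> V" if "x \<in> V" "x \<noteq> r" for x using p_in[OF that] uw by (simp add: p'_def)
  ultimately have "rooted_tree V r p' d' (insert {w, u} (E - {{r, u}}))"
    using finite_V root p_root uw by unfold_locales (auto simp: p'_def)
  then show "is_tree (V, insert {w, u} (E - {{r, u}}))" by (rule rooted_tree.is_tree)
  show "{w, u} \<notin> E" using uw unfolding edge_iff children_def by auto
qed

text \<open>Used to recover \<open>w\<close> after \<open>u\<close> has been moved below it:
  \<open>w\<close> is then the common neighbour of the root and \<open>u\<close>.\<close>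

lemma (in rooted_tree) common_neighbor_unique:
  assumes "{r, x} \<in> E" "{x, u} \<in> E" "u \<noteq> r"
  shows "x = p u"
proof -
  have x: "x \<in> children r" using assms(1) neighbors_eq[of r] by auto
  then have "u \<noteq> p x" using childrenD assms(3) by metis
  then have "u \<in> children x" using assms(2) neighbors_eq[of x] by (auto split: if_splits)
  then show ?thesis using childrenD by metis
qed

lemma finite_neighbors: "simple_graph G \<Longrightarrow> finite {w. {v, w} \<in> snd G}"
  using simple_graph_edgeD(2) by (metis (no_types, lifting) finite_subset mem_Collect_eq simple_graph_def subsetI)

lemma (in rooted_tree) sum_degrees: "(\<Sum>v\<in>V. Suc (vertex_degree (V, E) v)) \<le> 3 * card V"
proof -
  have "vertex_degree (V, E) v \<le> card (children v) + 1" for v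
    using card_Un_le[of "children v" "{p v}"] finite_children[of v]
    by (auto simp: vertex_degree_def neighbors_eq card_insert_if)
  then have "(\<Sum>v\<in>V. Suc (vertex_degree (V, E) v)) \<le> (\<Sum>v\<in>V. 2 + card (children v))"
    by (intro sum_mono) simp
  also have "\<dots> = 2 * card V + (\<Sum>v\<in>V. \<Sum>u\<in>children v. 1)" by (simp add: sum_Suc)
  also have "(\<Sum>v\<in>V. \<Sum>u\<in>children v. 1) = (\<Sum>u\<in>V - {r}. 1::nat)"
    unfolding children_def using finite_V p_in by (intro sum.group) auto
  also have "\<dots> \<le> card V" using finite_V by (simp add: card_mono)
  finally show ?thesis by simp
qed

text \<open>The sum of \<open>Suc\<close> of the degrees is at most \<open>3 * n\<close>, so at most
  \<open>3 * 36\<close> vertices reach \<open>n / 36\<close>. The \<open>Suc\<close> allows for the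
  neighbour that a hub loses in the switch.\<close>

lemma card_near_hubs:
  assumes "is_tree G"
  shows "card {v \<in> fst G. card (fst G) \<le> 36 * Suc (vertex_degree G v)} \<le> 108"
proof -
  obtain r where r: "r \<in> fst G" using assms by (auto simp: is_tree_def graph_connected_def)
  obtain p d where "rooted_tree (fst G) r p d (snd G)"
    using rooted_tree_of_is_tree[OF assms r] by blast
  then interpret rooted_tree "fst G" r p d "snd G" .
  let ?n = "card (fst G)"
  let ?H = "{v \<in> fst G. ?n \<le> 36 * Suc (vertex_degree G v)}"
  have "?n * card ?H \<le> (\<Sum>v\<in>?H. 36 * Suc (vertex_degree G v))"
    using sum_bounded_below[of ?H ?n "\<lambda>v. 36 * Suc (vertex_degree G v)"] by (simp add: mult.commute)
  also have "\<dots> \<le> (\<Sum>v\<in>fst G. 36 * Suc (vertex_degree G v))"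
    using finite_V by (intro sum_mono2) auto
  also have "\<dots> = 36 * (\<Sum>v\<in>fst G. Suc (vertex_degree G v))" by (simp add: sum_distrib_left)
  also have "\<dots> \<le> ?n * 108" using sum_degrees by simp
  finally have "?n * card ?H \<le> ?n * 108" .
  moreover have "?n > 0" using r finite_V card_gt_0_iff by blast
  ultimately show ?thesis by simp
qed

text \<open>Double counting of switches: a tree with a hub admits at least
  \<open>q * (q - 1)\<close> of them, and a switch is determined by the resulting tree, one of at
  most 108 near-hubs \<open>v\<close>, and a vertex \<open>u\<close>.\<close>

lemma card_labeled_trees_with_hub:
  "card {T \<in> labeled_trees n. has_hub T} * ((n div 36) * (n div 36 - 1))
    \<le> card (labeled_trees n) * (108 * n)"
proof -
  define L where "L = labeled_trees n"
  define Bad where "Bad = {T \<in> L. \<exists>v\<in>fst T. n \<le> 36 * vertex_degree T v}"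
  define q where "q = n div 36"
  define N where "N T v = {w. {v, w} \<in> snd T}" for T :: "nat sgraph" and v
  have L: "is_tree T" "simple_graph T" "fst T = {1..n}" if "T \<in> L" for T
    using that by (auto simp: L_def labeled_trees_def is_tree_def)
  have finL: "finite L" by (simp add: L_def finite_labeled_trees)
  have finN: "finite (N T v)" if "T \<in> L" for T v
    unfolding N_def using finite_neighbors[OF L(2)[OF that]] .
  have NV: "N T v \<subseteq> {1..n}" if "T \<in> L" for T v
    using simple_graph_edgeD(2)[OF L(2)[OF that]] L(3)[OF that] by (auto simp: N_def)
  define M where "M T = (SIGMA v:{v \<in> fst T. n \<le> 36 * vertex_degree T v}. SIGMA u:N T v. N T v - {u})" for T
  have finM: "finite (M T)" if "T \<in> L" for T
    unfolding M_def using L(3)[OF that] finN[OF that] by (intro finite_SigmaI) auto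
  have cM: "q * (q - 1) \<le> card (M T)" if T: "T \<in> Bad" for T
  proof -
    have TL: "T \<in> L" using T by (simp add: Bad_def)
    obtain v where v: "v \<in> fst T" "n \<le> 36 * vertex_degree T v" using T by (auto simp: Bad_def)
    have "q \<le> vertex_degree T v" using v(2) by (simp add: q_def)
    then have q: "q \<le> card (N T v)" by (simp add: vertex_degree_def N_def)
    have "q * (q - 1) \<le> card (N T v) * (card (N T v) - 1)" using q by (intro mult_le_mono) auto
    also have "\<dots> = card (SIGMA u:N T v. N T v - {u})"
      using finN[OF TL] by simp
    also have "\<dots> = card ({v} \<times> (SIGMA u:N T v. N T v - {u}))" by (simp add: card_cartesian_product)
    also have "\<dots> \<le> card (M T)"
      using v by (intro card_mono finM[OF TL]) (auto simp: M_def)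
    finally show ?thesis .
  qed
  \<comment> \<open>The vertex \<open>w\<close> is dropped, since the new tree with \<open>v\<close>
    and \<open>u\<close> determines it.\<close>
  define \<Phi> where "\<Phi> = (\<lambda>(T :: nat sgraph, v, u, w). ((fst T, insert {w, u} (snd T - {{v, u}})), v, u))"
  define D where "D = (SIGMA T:Bad. M T)"
  have switch: "(fst T, insert {w, u} (snd T - {{v, u}})) \<in> L" "{w, u} \<notin> snd T"
      "n \<le> 36 * Suc (vertex_degree (fst T, insert {w, u} (snd T - {{v, u}})) v)"
      "v \<in> {1..n}" "u \<in> {1..n}" "u \<noteq> v" "w \<noteq> u" "w \<noteq> v" "{v, u} \<in> snd T" "{v, w} \<in> snd T"
    if "(T, v, u, w) \<in> D" for T v u w
  proof -
    have a: "T \<in> L" "v \<in> fst T" "n \<le> 36 * vertex_degree T v" "u \<in> N T v" "w \<in> N T v" "u \<noteq> w"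
      using that by (auto simp: D_def M_def Bad_def)
    obtain p d where "rooted_tree (fst T) v p d (snd T)"
      using rooted_tree_of_is_tree[OF L(1)[OF a(1)] a(2)] by blast
    then interpret rooted_tree "fst T" v p d "snd T" .
    have N: "N T v = children v" by (simp add: N_def neighbors_eq)
    show "(fst T, insert {w, u} (snd T - {{v, u}})) \<in> L"
      using reattach_child(1)[of u w] a L(3)[OF a(1)] N by (simp add: L_def labeled_trees_def)
    show "{w, u} \<notin> snd T" using reattach_child(2)[of u w] a N by simp
    show uv: "{v, u} \<in> snd T" "{v, w} \<in> snd T" using a by (auto simp: N_def)
    show "u \<noteq> v" "w \<noteq> v" "w \<noteq> u" using edgeD[OF uv(1)] edgeD[OF uv(2)] a by auto
    show "v \<in> {1..n}" "u \<in> {1..n}" using a(2,4) L(3)[OF a(1)] NV[OF a(1), of v] by blast+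
    have "{x. {v, x} \<in> insert {w, u} (snd T - {{v, u}})} = N T v - {u}"
      using \<open>u \<noteq> v\<close> \<open>w \<noteq> v\<close> by (auto simp: N_def doubleton_eq_iff)
    then have "Suc (vertex_degree (fst T, insert {w, u} (snd T - {{v, u}})) v) = vertex_degree T v"
      using a(4) finN[OF a(1)] card_Suc_Diff1[of "N T v" u] by (simp add: vertex_degree_def N_def)
    then show "n \<le> 36 * Suc (vertex_degree (fst T, insert {w, u} (snd T - {{v, u}})) v)" using a(3) by simp
  qed
  have "inj_on \<Phi> D"
  proof (rule inj_onI)
    fix x y assume x: "x \<in> D" and y: "y \<in> D" and eq: "\<Phi> x = \<Phi> y"
    obtain T v u w T' v' u' w' where xy: "x = (T, v, u, w)" "y = (T', v', u', w')"
      by (metis prod_cases4)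
    have eq': "fst T = fst T' \<and> insert {w, u} (snd T - {{v, u}}) = insert {w', u'} (snd T' - {{v', u'}}) \<and>
        v = v' \<and> u = u'"
      using eq[unfolded xy \<Phi>_def prod.case prod.inject conj_assoc] .
    have e: "v' = v" "u' = u" "fst T' = fst T"
      using eq' by (simp_all only:)
    have "insert {w', u} (snd T' - {{v, u}}) = insert {w, u} (snd T - {{v, u}})"
      using eq'[THEN conjunct2, THEN conjunct1] unfolding e(1,2) by (rule sym)
    note e = e this
    have x': "(T, v, u, w) \<in> D" using x by (simp only: xy)
    have y': "(T', v', u', w') \<in> D" using y by (simp only: xy)
    note s = switch[OF x'] and s' = switch[OF y']
    let ?S = "(fst T, insert {w, u} (snd T - {{v, u}}))"
    have "v \<in> fst ?S" unfolding L(3)[OF s(1)] by (rule s(4))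
    then obtain p d where "rooted_tree (fst ?S) v p d (snd ?S)"
      using rooted_tree_of_is_tree[OF L(1)[OF s(1)], of v] by blast
    then interpret rooted_tree "fst ?S" v p d "snd ?S" .
    have "{v, w} \<in> snd ?S" "{w, u} \<in> snd ?S" using s by (auto simp: doubleton_eq_iff)
    then have "w = p u" using common_neighbor_unique s(6) by blast
    moreover have "{v, w'} \<in> insert {w', u} (snd T' - {{v, u}})"
      using s'(7,10) e(1,2) by (simp add: doubleton_eq_iff)
    then have "{v, w'} \<in> snd ?S" "{w', u} \<in> snd ?S" unfolding snd_conv e(4)[symmetric] by auto
    then have "w' = p u" using common_neighbor_unique s(6) by blast
    ultimately have w: "w' = w" by simp
    \<comment> \<open>The switch can be undone: \<open>{w, u}\<close> was not an edge before, and
      \<open>{v, u}\<close> was.\<close>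
    have "snd T = insert {v, u} (snd ?S - {{w, u}})" using s(2,9) by auto
    moreover have "snd T' = insert {v, u} (snd ?S - {{w, u}})"
      using s'(2,9) unfolding snd_conv e(4)[symmetric] unfolding e(1,2) w by auto
    ultimately show "x = y" using e w by (simp add: xy prod_eq_iff)
  qed
  moreover have "\<Phi> ` D \<subseteq> (SIGMA T:L. {v \<in> fst T. card (fst T) \<le> 36 * Suc (vertex_degree T v)} \<times> {1..n})"
  proof (rule image_subsetI)
    fix x assume x: "x \<in> D"
    obtain T v u w where xy: "x = (T, v, u, w)" by (metis prod_cases4)
    have x': "(T, v, u, w) \<in> D" using x by (simp only: xy)
    note s = switch[OF x']
    show "\<Phi> x \<in> (SIGMA T:L. {v \<in> fst T. card (fst T) \<le> 36 * Suc (vertex_degree T v)} \<times> {1..n})"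
      using s(1,3,4,5) L(3)[OF s(1)] by (simp add: xy \<Phi>_def)
  qed
  moreover have "finite (SIGMA T:L. {v \<in> fst T. card (fst T) \<le> 36 * Suc (vertex_degree T v)} \<times> {1..n})"
    using finL L(3) by (intro finite_SigmaI) auto
  ultimately have "card D \<le> card (SIGMA T:L. {v \<in> fst T. card (fst T) \<le> 36 * Suc (vertex_degree T v)} \<times> {1..n})"
    by (rule card_inj_on_le)
  also have "\<dots> = (\<Sum>T\<in>L. card {v \<in> fst T. card (fst T) \<le> 36 * Suc (vertex_degree T v)} * n)"
    using finL L(3) by (subst card_SigmaI) (auto simp: card_cartesian_product)
  also have "\<dots> \<le> card L * (108 * n)"
    using sum_bounded_above[of L "\<lambda>T. card {v \<in> fst T. card (fst T) \<le> 36 * Suc (vertex_degree T v)} * n" "108 * n"]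
      card_near_hubs[OF L(1)] by (simp add: mult_le_mono1)
  finally have "card D \<le> card L * (108 * n)" .
  moreover have "card Bad * (q * (q - 1)) \<le> card D"
  proof -
    have fB: "finite Bad" using finL by (simp add: Bad_def)
    have "card Bad * (q * (q - 1)) \<le> (\<Sum>T\<in>Bad. card (M T))"
      using sum_bounded_below[of Bad "q * (q - 1)" "\<lambda>T. card (M T)"] cM by simp
    also have "\<dots> = card D" unfolding D_def
      using fB finM by (subst card_SigmaI) (auto simp: Bad_def)
    finally show ?thesis .
  qed
  moreover have "has_hub T \<longleftrightarrow> (\<exists>v\<in>fst T. n \<le> 36 * vertex_degree T v)" if "T \<in> L" for T
    using L(3)[OF that] by (simp add: has_hub_def)
  then have "Bad = {T \<in> labeled_trees n. has_hub T}"
    unfolding Bad_def L_def by blast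
  ultimately show ?thesis unfolding L_def q_def by simp
qed

section \<open>Proportions\<close>

lemma strongly_balanced_if_no_hub:
  assumes "T \<in> labeled_trees n" "\<not> has_hub T" "3 \<le> k" "k \<le> n" "36 < n"
  shows "strongly_balanced k T"
  using assms labeled_treesD[OF assms(1)]
  by (intro strongly_balanced_if_small_degrees) (auto simp: has_hub_def not_le)

lemma labeled_trees_nonempty: "1 \<le> n \<Longrightarrow> labeled_trees n \<noteq> {}"
  \<comment> \<open>The witness is the star with \<open>n - 1\<close> leaves.\<close>
  using ex_labeled_tree_with_shape[of "Node (replicate_mset (n - 1) (Node {#}))"] by auto

lemma unlabeled_trees_nonempty: "1 \<le> n \<Longrightarrow> unlabeled_trees n \<noteq> {}"
  using labeled_trees_nonempty[of n] quotientI[of _ "labeled_trees n"] unfolding unlabeled_trees_eq by blast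

text \<open>Nonemptiness is asked for eventually only: there is no tree on 0 vertices, where the
  proportion is \<open>0 / 0 = 0\<close>.\<close>

lemma proportion_tendsto_1:
  fixes A :: "nat \<Rightarrow> 'a set" and g :: "nat \<Rightarrow> real"
  assumes fin: "\<And>n. finite (A n)"
    and bound: "eventually (\<lambda>n. A n \<noteq> {} \<and> card {x \<in> A n. \<not> P x} \<le> g n * card (A n)) sequentially"
    and g: "g \<longlonglongrightarrow> 0"
  shows "(\<lambda>n. card {x \<in> A n. P x} / card (A n)) \<longlonglongrightarrow> 1"
proof (rule tendsto_sandwich[of "\<lambda>n. 1 - g n"])
  show "(\<lambda>n. 1 - g n) \<longlonglongrightarrow> 1" using tendsto_diff[OF tendsto_const g, of 1] by simp
  show "eventually (\<lambda>n. 1 - g n \<le> card {x \<in> A n. P x} / card (A n)) sequentially"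
    using bound
  proof eventually_elim
    case (elim n)
    have "card (A n) = card ({x \<in> A n. P x} \<union> {x \<in> A n. \<not> P x})" by (rule arg_cong[of _ _ card]) auto
    also have "\<dots> = card {x \<in> A n. P x} + card {x \<in> A n. \<not> P x}"
      using fin by (intro card_Un_disjoint) auto
    finally have "real (card (A n)) = real (card {x \<in> A n. P x}) + real (card {x \<in> A n. \<not> P x})" by simp
    moreover have "0 < card (A n)" using elim fin by (simp add: card_gt_0_iff)
    ultimately show ?case using elim by (simp add: field_simps)
  qed
  show "eventually (\<lambda>n. card {x \<in> A n. P x} / card (A n) \<le> 1) sequentially"
    using fin by (intro always_eventually allI divide_le_eq_1[THEN iffD2])
      (auto simp: card_gt_0_iff intro: card_mono)
qed simp

lemma div_lower_bound: "real n / real d - 1 \<le> real (n div d)" for n d :: nat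
  using floor_divide_of_nat_eq[of n d, where 'a = real] by linarith

lemma le_quotient_mult:
  fixes a b c d e :: real
  assumes "a \<le> b" "b * c \<le> d * e" "0 < c"
  shows "a \<le> e / c * d"
proof -
  have "a * c \<le> d * e" using mult_right_mono[OF assms(1), of c] assms(2,3) by linarith
  then show ?thesis using assms(3) by (simp add: field_simps)
qed

lemma labeled_trees_strongly_balanced:
  assumes k: "3 \<le> k"
  shows "(\<lambda>n. card {T \<in> labeled_trees n. strongly_balanced k T} / card (labeled_trees n)) \<longlonglongrightarrow> 1"
proof (rule proportion_tendsto_1[where g = "\<lambda>n. 108 * real n / ((real n / 36 - 1) * (real n / 36 - 2))"])
  show "(\<lambda>n::nat. 108 * real n / ((real n / 36 - 1) * (real n / 36 - 2))) \<longlonglongrightarrow> 0" by real_asymp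
  show "eventually (\<lambda>n. labeled_trees n \<noteq> {} \<and> real (card {T \<in> labeled_trees n. \<not> strongly_balanced k T})
      \<le> 108 * real n / ((real n / 36 - 1) * (real n / 36 - 2)) * card (labeled_trees n)) sequentially"
    \<comment> \<open>Beyond 72 the factor \<open>n / 36 - 2\<close> is positive, and
      \<open>k \<le> n\<close> is what the colouring result asks for.\<close>
    using eventually_gt_at_top[of "72 + k"]
  proof eventually_elim
    case (elim n)
    let ?b = "card {T \<in> labeled_trees n. has_hub T}" and ?q = "n div 36"
    have "card {T \<in> labeled_trees n. \<not> strongly_balanced k T} \<le> ?b"
      using elim k strongly_balanced_if_no_hub[of _ n k]
      by (intro card_mono) (auto simp: finite_labeled_trees)
    moreover have "real ?b * ((n / 36 - 1) * (n / 36 - 2)) \<le> card (labeled_trees n) * (108 * real n)"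
    proof -
      have "?q \<ge> 1" using elim by simp
      then have "real (?q - 1) \<ge> n / 36 - 2" "real ?q \<ge> n / 36 - 1" using div_lower_bound[of n 36] by simp_all
      then have "(n / 36 - 1) * (n / 36 - 2) \<le> real ?q * real (?q - 1)"
        using elim by (intro mult_mono) auto
      then have "real ?b * ((n / 36 - 1) * (n / 36 - 2)) \<le> real ?b * (real ?q * real (?q - 1))"
        by (intro mult_left_mono) auto
      also have "\<dots> = real (?b * (?q * (?q - 1)))" by simp
      also have "\<dots> \<le> real (card (labeled_trees n) * (108 * n))"
        using card_labeled_trees_with_hub[of n] of_nat_le_iff by blast
      finally show ?thesis by simp
    qed
    moreover have "0 < (real n / 36 - 1) * (real n / 36 - 2)" using elim by (intro mult_pos_pos) auto
    ultimately show ?case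
      using labeled_trees_nonempty[of n] elim by (intro conjI le_quotient_mult[of _ "real ?b"]) auto
  qed
qed (rule finite_labeled_trees)

lemma unlabeled_trees_strongly_balanced:
  assumes k: "3 \<le> k"
  shows "(\<lambda>n. card {C \<in> unlabeled_trees n. unlabeled_strongly_balanced k C} / card (unlabeled_trees n)) \<longlonglongrightarrow> 1"
proof -
  \<comment> \<open>The number of possible triples of removed branches, independent of
    \<open>n\<close>. The bound on the proportion is thus of order \<open>n^2 / n^3\<close>.\<close>
  define K where "K = card {t. nodes t \<le> 72} ^ 3"
  show ?thesis
  proof (rule proportion_tendsto_1[where g = "\<lambda>n. real K * real n ^ 2 / (real n / 108 - 2) ^ 3"])
    show "(\<lambda>n::nat. real K * real n ^ 2 / (real n / 108 - 2) ^ 3) \<longlonglongrightarrow> 0" by real_asymp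
    show "eventually (\<lambda>n. unlabeled_trees n \<noteq> {} \<and>
        real (card {C \<in> unlabeled_trees n. \<not> unlabeled_strongly_balanced k C})
        \<le> real K * real n ^ 2 / (real n / 108 - 2) ^ 3 * card (unlabeled_trees n)) sequentially"
      using eventually_gt_at_top[of "216 + k"]
    proof eventually_elim
      case (elim n)
      let ?b = "card {C \<in> unlabeled_trees n. \<exists>G\<in>C. has_hub G}" and ?m = "n div 108 - 1"
      let ?r = "card {t \<in> rtrees n. n \<le> 36 * size (subtrees t)}" and ?u = "card (unlabeled_trees n)"
      have "card {C \<in> unlabeled_trees n. \<not> unlabeled_strongly_balanced k C} \<le> ?b"
        using elim k strongly_balanced_if_no_hub[of _ n k] class_subset[of _ n]
        unfolding unlabeled_strongly_balanced_def
        by (intro card_mono) (simp add: finite_unlabeled_trees, fastforce)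
      also have "?b \<le> ?r" by (rule card_classes_with_hub)
      finally have b: "card {C \<in> unlabeled_trees n. \<not> unlabeled_strongly_balanced k C} \<le> ?r" .
      have "real ?r * (n / 108 - 2) ^ 3 \<le> ?u * (real K * real n ^ 2)"
      proof -
        have "1 \<le> n div 108" using elim by simp
        then have "n / 108 - 2 \<le> real ?m" using div_lower_bound[of n 108] by simp
        then have "real ?r * (n / 108 - 2) ^ 3 \<le> real ?r * real ?m ^ 3"
          using elim by (intro mult_left_mono power_mono) auto
        also have "\<dots> = real (?r * ?m ^ 3)" by simp
        also have "?r * ?m ^ 3 \<le> card (rtrees n) * n * K"
          unfolding K_def using elim by (intro card_large_root_degree) simp
        \<comment> \<open>Passing from rooted trees to classes costs the second factor
          \<open>n\<close>.\<close>
        also have "\<dots> \<le> (n * ?u) * n * K" by (intro mult_le_mono card_rtrees_le) auto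
        finally show ?thesis by (simp add: power2_eq_square mult_ac)
      qed
      moreover have "0 < (real n / 108 - 2) ^ 3" using elim by (intro zero_less_power) auto
      ultimately show ?case
        using unlabeled_trees_nonempty[of n] elim b by (intro conjI le_quotient_mult[of _ "real ?r"]) auto
    qed
  qed (rule finite_unlabeled_trees)
qed

theorem theoremB:
  fixes k :: nat
  assumes "k \<ge> 3"
  shows "((\<lambda>n. real (card {T \<in> labeled_trees n. strongly_balanced k T}) /
               real (card (labeled_trees n))) \<longlonglongrightarrow> 1) \<and>
         ((\<lambda>n. real (card {C \<in> unlabeled_trees n. unlabeled_strongly_balanced k C}) /
               real (card (unlabeled_trees n))) \<longlonglongrightarrow> 1)"
  using labeled_trees_strongly_balanced[OF assms] unlabeled_trees_strongly_balanced[OF assms] by blast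

end
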